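(* For every $p\in[0,1/2)$, the insertion-based noisy sorting capacity satisfies $$C_{\mathrm{ins}}(p)\le \frac{1}{\frac{1}{1-H(p)}+\frac{1}{D(p\|1-p)}}.$$
   Context: Noisy sorting problem. Fix $p\in[0,1/2)$. Let $\theta_1,\ldots,\theta_n$ be distinct reals with ordering $\pi$ ($\theta_{\pi(1)}<\cdots<\theta_{\pi(n)}$). A query is a pair $(U_k,V_k)=(\theta_i,\theta_j)$, $i\ne j$, answered by $Y_k=\mathbb{1}_{\{U_k<V_k\}}\oplus Z_k$ with $Z_k$ i.i.d. $\mathrm{Bern}(p)$. Insertion-based noisy sorting codes: start with the list $(\theta_n)$; for $i=1,\ldots,n-1$, given the current estimated ordered list $(\theta_{\sigma(1)},\ldots,\theta_{\sigma(i)})$ of the elements $\theta_{n-i+1},\ldots,\theta_n$, run a noisy searching procedure (adaptive, possibly randomized, possibly with a response-dependent number of queries) whose queries compare $\theta_{n-i}$ with elements of the list, producing an estimated position $\hat l\in[i+1]$, and insert $\theta_{n-i}$ into the list at position $\hat l$ (i.e., the list becomes $(\sigma(1),\ldots,\sigma(\hat l-1),n-i,\sigma(\hat l),\ldots,\sigma(i))$); after $n-1$ insertions the final list is the estimate $\hat\Pi$. Different choices of the searching procedure give different codes. Its rate is $R=\frac{n\log_2 n}{\mathbb{E}[M]}$, where $M$ is the total number of queries over all insertions. A rate $R_{\mathrm{ins}}$ is insertion-sort-achievable if there is a sequence (indexed by $n$) of insertion-based codes of rate $R_{\mathrm{ins}}$ with $\lim_{n\to\infty}\max_\pi\mathbb{P}\{\hat\Pi\ne\pi\}=0$;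 $C_{\mathrm{ins}}(p)$ is the supremum of such rates. $H(p)=-p\log_2 p-(1-p)\log_2(1-p)$ and $D(p\|1-p)=p\log_2\frac{p}{1-p}+(1-p)\log_2\frac{1-p}{p}$ (with the convention $1/\infty=0$ when $p=0$). *)

theory Defs
  imports "HOL-Probability.Probability"
begin

definition H2 :: "real \<Rightarrow> real" where
  "H2 p = - p * log 2 p - (1 - p) * log 2 (1 - p)"

definition Dpq :: "real \<Rightarrow> real" where
  "Dpq p = p * log 2 (p / (1 - p)) + (1 - p) * log 2 ((1 - p) / p)"

text \<open>The claimed upper bound, with the convention 1/D = 1/infinity = 0 for p = 0.\<close>
definition ins_bound :: "real \<Rightarrow> real" where
  "ins_bound p = 1 / (1 / (1 - H2 p) + (if p = 0 then 0 else 1 / Dpq p))"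

text \<open>Actions of a noisy searching procedure run on a list of length i:
  Ask j (j in 1..i) compares the new element with the j-th list element;
  Stop l (l in 1..i+1) ends the search with estimated position l.\<close>
datatype act = Stop nat | Ask nat

text \<open>Adaptive randomized (behavioural) strategy: the next action is drawn from a
  distribution depending on the history of (queried position, response) pairs,
  stored newest first.\<close>
type_synonym strat = "(nat \<times> bool) list \<Rightarrow> act pmf"

definition valid_strat :: "nat \<Rightarrow> strat \<Rightarrow> bool" where
  "valid_strat i s \<longleftrightarrow> (\<forall>h. set_pmf (s h) \<subseteq> Stop ` {1..i+1} \<union> Ask ` {1..i})"

text \<open>Probability that the run produces history h (all of whose steps are queries);
  b j is the true answer 1{U<V} to query Ask j, and the response is flipped w.p. p.\<close>
fun reach :: "real \<Rightarrow> strat \<Rightarrow> (nat \<Rightarrow> bool) \<Rightarrow> (nat \<times> bool) list \<Rightarrow> real" where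
  "reach p s b [] = 1"
| "reach p s b ((j, y) # h) = reach p s b h * pmf (s h) (Ask j) * (if y = b j then 1 - p else p)"

definition hists :: "nat \<Rightarrow> nat \<Rightarrow> (nat \<times> bool) list set" where
  "hists i k = {h. length h = k \<and> set h \<subseteq> {1..i} \<times> UNIV}"

definition stop_prob :: "real \<Rightarrow> strat \<Rightarrow> (nat \<Rightarrow> bool) \<Rightarrow> nat \<Rightarrow> nat \<Rightarrow> real" where
  "stop_prob p s b i l = (\<Sum>k. \<Sum>h\<in>hists i k. reach p s b h * pmf (s h) (Stop l))"

text \<open>Output distribution of the search (missing mass = never stops).\<close>
definition search_out :: "real \<Rightarrow> strat \<Rightarrow> (nat \<Rightarrow> bool) \<Rightarrow> nat \<Rightarrow> nat spmf" where
  "search_out p s b i = embed_spmf (stop_prob p s b i)"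

text \<open>Expected number of queries: E[M] = sum over k >= 1 of P(M >= k).\<close>
definition exp_queries :: "real \<Rightarrow> strat \<Rightarrow> (nat \<Rightarrow> bool) \<Rightarrow> nat \<Rightarrow> ennreal" where
  "exp_queries p s b i = (\<Sum>k. ennreal (\<Sum>h\<in>hists i (Suc k). reach p s b h))"

definition insert_at :: "nat list \<Rightarrow> nat \<Rightarrow> nat \<Rightarrow> nat list" where
  "insert_at L l x = take (l - 1) L @ x # drop (l - 1) L"

definition cmp_bits :: "(nat \<Rightarrow> real) \<Rightarrow> nat \<Rightarrow> nat list \<Rightarrow> nat \<Rightarrow> bool" where
  "cmp_bits \<theta> x L j = (\<theta> x < \<theta> (L ! (j - 1)))"

text \<open>An insertion-based code for n elements is S n i, the searching procedure used
  when the current list has i elements (i = 1..n-1), inserting theta_(n-i).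
  ins_list p S n theta k is the distribution of the list after k insertions.\<close>
fun ins_list :: "real \<Rightarrow> (nat \<Rightarrow> nat \<Rightarrow> strat) \<Rightarrow> nat \<Rightarrow> (nat \<Rightarrow> real) \<Rightarrow> nat \<Rightarrow> nat list spmf" where
  "ins_list p S n \<theta> 0 = return_spmf [n]"
| "ins_list p S n \<theta> (Suc k) =
     bind_spmf (ins_list p S n \<theta> k) (\<lambda>L.
       map_spmf (\<lambda>l. insert_at L l (n - Suc k))
         (search_out p (S n (Suc k)) (cmp_bits \<theta> (n - Suc k) L) (Suc k)))"

definition total_queries :: "real \<Rightarrow> (nat \<Rightarrow> nat \<Rightarrow> strat) \<Rightarrow> nat \<Rightarrow> (nat \<Rightarrow> real) \<Rightarrow> ennreal" where
  "total_queries p S n \<theta> =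
     (\<Sum>k<n - 1. \<integral>\<^sup>+ L. exp_queries p (S n (Suc k)) (cmp_bits \<theta> (n - Suc k) L) (Suc k)
                      \<partial>measure_spmf (ins_list p S n \<theta> k))"

definition err_prob :: "real \<Rightarrow> (nat \<Rightarrow> nat \<Rightarrow> strat) \<Rightarrow> nat \<Rightarrow> (nat \<Rightarrow> real) \<Rightarrow> real" where
  "err_prob p S n \<theta> = 1 - spmf (ins_list p S n \<theta> (n - 1)) (sort_key \<theta> [1..<n+1])"

definition ins_achievable :: "real \<Rightarrow> real \<Rightarrow> bool" where
  "ins_achievable p R \<longleftrightarrow> (\<exists>S :: nat \<Rightarrow> nat \<Rightarrow> strat.
     (\<forall>n i. valid_strat i (S n i)) \<and>
     (\<forall>\<^sub>F n in sequentially.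
        ennreal R * (SUP \<theta>\<in>{\<theta>. inj_on \<theta> {1..n}}. total_queries p S n \<theta>)
          \<le> ennreal (real n * log 2 (real n))) \<and>
     (\<lambda>n. SUP \<theta>\<in>{\<theta>. inj_on \<theta> {1..n}}. err_prob p S n \<theta>) \<longlonglongrightarrow> 0)"

definition C_ins :: "real \<Rightarrow> ereal" where
  "C_ins p = Sup {ereal R | R. ins_achievable p R}"

end

theory Submission
  imports Defs "HOL-Real_Asymp.Real_Asymp"
begin

text \<open>
  A single search among \<open>m\<close> positions with error \<open>e\<close> is a variable-length code with feedback over a
  binary symmetric channel, and obeys a Burnashev-type converse
  \<open>E[T] \<ge> log m / (1 - H(p)) + log n / D - o(log n) - O(n e)\<close> for \<open>n \<ge> m\<close>. It comes from a potential of the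
  posterior that drops by at most \<open>1\<close> per query in expectation: entropy divided by the capacity while no
  position dominates, and negative average log odds divided by \<open>D\<close> (plus an offset) afterwards.
  The logarithm in the terminal value is bounded by its tangent at error level \<open>1/n\<close>, which makes the bound linear
  in \<open>e\<close>.

  Every choice of insertion positions is realised by some ordering, and on the event that all earlier
  insertions are correct the searches have fixed answers. Hence the success probability is the
  product of the individual ones; choosing the worst positions shows that the worst-case errors of the
  searches add up to \<open>O(1)\<close>, and summing the single-search bound over all insertions yields
  \<open>n log n (1 / (1 - H(p)) + 1 / D)\<close> up to lower order.
\<close>

subsection \<open>Entropy and log-likelihood functionals of unnormalised posteriors\<close>

definition xlog :: "real \<Rightarrow> real" where
  "xlog x = x * log 2 x"

text \<open>Weight vectors \<open>w\<close> are unnormalised posteriors; all functionals are homogeneous of degree one, so that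
  summing them over histories computes expectations without any division. With total weight \<open>Z\<close>,
  \<open>ent\<close> is \<open>Z\<close> times the posterior entropy, and \<open>llr\<close> is \<open>- Z\<close> times the average posterior log odds
  of the true hypothesis.\<close>
definition ent :: "'a set \<Rightarrow> ('a \<Rightarrow> real) \<Rightarrow> real" where
  "ent I w = xlog (sum w I) - (\<Sum>l\<in>I. xlog (w l))"

definition llr :: "'a set \<Rightarrow> ('a \<Rightarrow> real) \<Rightarrow> real" where
  "llr I w = (\<Sum>l\<in>I. w l * log 2 (sum w I - w l) - xlog (w l))"

definition upd :: "real \<Rightarrow> ('a \<Rightarrow> bool) \<Rightarrow> bool \<Rightarrow> ('a \<Rightarrow> real) \<Rightarrow> 'a \<Rightarrow> real" where
  "upd p b y w l = w l * (if y = b l then 1 - p else p)"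

lemma xlog_mult: "0 \<le> x \<Longrightarrow> 0 \<le> y \<Longrightarrow> xlog (x * y) = y * xlog x + x * xlog y"
  by (cases "x = 0"; cases "y = 0") (auto simp: xlog_def log_mult algebra_simps)

text \<open>Gibbs' inequality against the uniform weights \<open>S / card J\<close>: the bound ln x
  \<le> x - 1 is applied to each ratio of uniform weight to \<open>w l\<close>, and the resulting
  linear errors sum to zero. Zero weights are harmless because they contribute nothing to either
  side.\<close>

lemma ent_le:
  assumes "finite J" "\<And>l. l \<in> J \<Longrightarrow> 0 \<le> w l"
  shows "ent J w \<le> sum w J * log 2 (card J)"
proof (cases "sum w J = 0")
  case True
  then have "\<And>l. l \<in> J \<Longrightarrow> w l = 0" using assms by (simp add: sum_nonneg_eq_0_iff)
  then show ?thesis using True by (simp add: ent_def xlog_def)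
next
  case False
  define S where "S = sum w J"
  have S: "S > 0" using False assms sum_nonneg[of J w] by (auto simp: S_def less_le)
  have M: "card J > 0" using False assms(1) by (metis card_gt_0_iff sum.empty)
  have term_le: "w l * log 2 (S / card J) - xlog (w l) \<le> (S / card J - w l) / ln 2" if "l \<in> J" for l
  proof (cases "w l = 0")
    case True then show ?thesis using S by (simp add: xlog_def)
  next
    case False
    then have w: "w l > 0" using assms(2)[OF that] by simp
    have "ln (S / card J / w l) \<le> S / card J / w l - 1"
      using w S M by (intro ln_le_minus_one) simp
    then have "w l * ln (S / card J / w l) \<le> w l * (S / card J / w l - 1)"
      using w by (intro mult_left_mono) auto
    also have "\<dots> = S / card J - w l" using w by (simp add: field_simps)
    also have "ln (S / card J / w l) = ln (S / card J) - ln (w l)"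
      using w S M by (subst ln_div) auto
    finally have "w l * (ln (S / card J) - ln (w l)) / ln 2 \<le> (S / card J - w l) / ln 2"
      by (intro divide_right_mono) auto
    then show ?thesis by (simp add: xlog_def log_def diff_divide_distrib right_diff_distrib)
  qed
  have "(\<Sum>l\<in>J. w l * log 2 (S / card J) - xlog (w l)) \<le> (\<Sum>l\<in>J. (S / card J - w l) / ln 2)"
    by (intro sum_mono term_le)
  also have "\<dots> = 0"
    using M by (simp add: sum_divide_distrib[symmetric] sum_subtractf S_def)
  finally have "S * log 2 (S / card J) \<le> (\<Sum>l\<in>J. xlog (w l))"
    by (simp add: sum_subtractf sum_distrib_right[symmetric] S_def)
  then show ?thesis using S M by (simp add: ent_def xlog_def S_def[symmetric] log_divide algebra_simps)
qed

text \<open>Two-point case of \<open>ent_le\<close>: a binary choice carries at most one bit per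
  unit of mass.\<close>

lemma xlog_add_le:
  assumes "0 \<le> x" "0 \<le> y"
  shows "xlog (x + y) \<le> xlog x + xlog y + (x + y)"
proof -
  have "ent UNIV (\<lambda>b. if b then x else y) \<le> sum (\<lambda>b. if b then x else y) UNIV * log 2 (card (UNIV :: bool set))"
    using assms by (intro ent_le) auto
  then show ?thesis by (simp add: ent_def UNIV_bool algebra_simps)
qed

text \<open>Fano's inequality without normalisation. By the chain rule, deciding between
  \<open>l\<close> and the rest costs at most one bit per unit of mass, and only the mass outside
  \<open>l\<close> pays for the choice among the rest.\<close>

lemma fano:
  assumes "finite I" "\<And>l. l \<in> I \<Longrightarrow> 0 \<le> w l" "l \<in> I"
  shows "ent I w \<le> sum w I + (sum w I - w l) * log 2 (card I)"
proof -
  define R where "R = sum w (I - {l})"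
  have Z: "sum w I = w l + R" using assms by (simp add: R_def sum.remove)
  have R0: "0 \<le> R" using assms by (auto simp: R_def intro!: sum_nonneg)
  have "ent (I - {l}) w \<le> R * log 2 (card (I - {l}))"
    unfolding R_def using assms by (intro ent_le) auto
  \<comment> \<open>Monotonicity of the logarithm needs a nonempty rest; if \<open>I = {l}\<close>,
    then \<open>R\<close> is an empty sum and both sides vanish.\<close>
  also have "\<dots> \<le> R * log 2 (card I)"
  proof (cases "I = {l}")
    case False
    then have "I - {l} \<noteq> {}" using assms(3) by auto
    then have "0 < card (I - {l})" using assms(1) by (simp add: card_gt_0_iff)
    moreover have "card (I - {l}) \<le> card I" using assms(1) by (simp add: card_Diff1_le)
    ultimately show ?thesis using R0 by (intro mult_left_mono) auto
  qed (simp add: R_def)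
  finally have "ent (I - {l}) w \<le> R * log 2 (card I)" .
  moreover have "(\<Sum>l\<in>I. xlog (w l)) = xlog (w l) + (\<Sum>l\<in>I - {l}. xlog (w l))"
    using assms by (simp add: sum.remove)
  ultimately show ?thesis
    using xlog_add_le[of "w l" R] assms R0 by (simp add: ent_def Z R_def[symmetric])
qed

section \<open>Effect of one noisy response on entropy and log odds\<close>

lemma upd_sum: "upd p b True w l + upd p b False w l = w l"
  by (simp add: upd_def algebra_simps)

lemma sum_upd: "sum (upd p b True w) I + sum (upd p b False w) I = sum w I"
  by (simp add: upd_sum sum.distrib[symmetric])

lemma upd_nonneg: "0 \<le> p \<Longrightarrow> p \<le> 1 \<Longrightarrow> 0 \<le> w l \<Longrightarrow> 0 \<le> upd p b y w l"
  by (simp add: upd_def)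

lemma upd_pos: "0 < p \<Longrightarrow> p < 1 \<Longrightarrow> 0 < w l \<Longrightarrow> 0 < upd p b y w l"
  by (simp add: upd_def)

text \<open>One response reveals at most the channel capacity: the response itself has at most one
  bit of entropy (\<open>xlog_add_le\<close>), and its conditional entropy given any hypothesis is
  exactly \<open>H2 p\<close>. The case p = 0 is included, since the noiseless converse uses
  it.\<close>

lemma ent_step:
  assumes p: "0 \<le> p" "p \<le> 1" and w: "\<And>l. l \<in> I \<Longrightarrow> 0 \<le> w l"
  shows "ent I w \<le> ent I (upd p b True w) + ent I (upd p b False w) + (1 - H2 p) * sum w I"
proof -
  have "xlog (upd p b True w l) + xlog (upd p b False w l) = xlog (w l) - H2 p * w l" if "l \<in> I" for l
    using p w[OF that] by (cases "b l") (simp_all add: upd_def xlog_mult H2_def, simp_all add: xlog_def algebra_simps)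
  then have "(\<Sum>l\<in>I. xlog (upd p b True w l)) + (\<Sum>l\<in>I. xlog (upd p b False w l))
      = (\<Sum>l\<in>I. xlog (w l)) - H2 p * sum w I"
    by (simp add: sum.distrib[symmetric] sum_subtractf[symmetric] sum_distrib_left)
  moreover have "xlog (sum w I) \<le> xlog (sum (upd p b True w) I) + xlog (sum (upd p b False w) I) + sum w I"
    using xlog_add_le[of "sum (upd p b True w) I" "sum (upd p b False w) I"] p w
    by (simp add: sum_upd sum_nonneg upd_nonneg)
  ultimately show ?thesis by (simp add: ent_def algebra_simps)
qed

text \<open>Write \<open>t\<close> as a convex combination of \<open>p\<close> and
  \<open>1 - p\<close>. Concavity of ln bounds the right side below by the same combination of its
  two endpoint values, and the endpoint \<open>t = p\<close> has the smaller value because p <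
  1/2.\<close>

lemma binary_cross_entropy_le:
  fixes p t :: real
  assumes p: "0 < p" "p < 1/2" and t: "p \<le> t" "t \<le> 1 - p"
  shows "(1 - p) * ln p + p * ln (1 - p) \<le> (1 - p) * ln t + p * ln (1 - t)"
proof -
  define u where "u = (t - p) / (1 - 2 * p)"
  have u: "0 \<le> u" "u \<le> 1" using p t by (auto simp: u_def field_simps)
  have tu: "t = (1 - u) * p + u * (1 - p)"
  proof -
    have "u * (1 - 2 * p) = t - p" using p by (simp add: u_def)
    then show ?thesis by (simp add: algebra_simps)
  qed
  have conc: "(1 - v) * ln x + v * ln y \<le> ln ((1 - v) * x + v * y)"
    if "0 \<le> v" "v \<le> 1" "0 < x" "0 < y" for v x y :: real
    using concave_onD[OF ln_concave, of v x y] that by simp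
  have a: "(1 - u) * ln p + u * ln (1 - p) \<le> ln t"
    unfolding tu using u p by (intro conc) auto
  have "(1 - u) * ln (1 - p) + u * ln p \<le> ln ((1 - u) * (1 - p) + u * p)"
    using u p by (intro conc) auto
  also have "(1 - u) * (1 - p) + u * p = 1 - t" unfolding tu by (simp add: algebra_simps)
  finally have b: "(1 - u) * ln (1 - p) + u * ln p \<le> ln (1 - t)" .
  have "0 \<le> u * (1 - 2 * p) * (ln (1 - p) - ln p)"
    using u p by (intro mult_nonneg_nonneg) auto
  then have "(1 - p) * ln p + p * ln (1 - p)
      \<le> (1 - p) * ((1 - u) * ln p + u * ln (1 - p)) + p * ((1 - u) * ln (1 - p) + u * ln p)"
    by (simp add: algebra_simps)
  also have "\<dots> \<le> (1 - p) * ln t + p * ln (1 - t)"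
    using a b p by (intro add_mono mult_left_mono) auto
  finally show ?thesis .
qed

text \<open>Homogeneous form with \<open>t = c / (c + d)\<close>. In \<open>llr_step\<close>,
  \<open>c\<close> and \<open>d\<close> are the masses of all rivals of a hypothesis after a
  response agreeing with it and after one contradicting it.\<close>

lemma log_cross_entropy_le:
  fixes p c d :: real
  assumes p: "0 < p" "p < 1/2" and cd: "p * (c + d) \<le> c" "p * (c + d) \<le> d" "0 < c + d"
  shows "log 2 (c + d) \<le> (1 - p) * log 2 c + p * log 2 d - p * log 2 (1 - p) - (1 - p) * log 2 p"
proof -
  have pos: "0 < c" "0 < d" using cd p by (smt (verit) mult_pos_pos)+
  have "(1 - p) * ln p + p * ln (1 - p) \<le> (1 - p) * ln (c / (c + d)) + p * ln (1 - c / (c + d))"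
    using p cd by (intro binary_cross_entropy_le) (auto simp: field_simps)
  also have "1 - c / (c + d) = d / (c + d)" using cd by (simp add: field_simps)
  finally have "ln (c + d) \<le> (1 - p) * ln c + p * ln d - p * ln (1 - p) - (1 - p) * ln p"
    using pos by (simp add: ln_div algebra_simps)
  then have "ln (c + d) / ln 2 \<le> ((1 - p) * ln c + p * ln d - p * ln (1 - p) - (1 - p) * ln p) / ln 2"
    by (intro divide_right_mono) auto
  then show ?thesis by (simp add: log_def add_divide_distrib diff_divide_distrib)
qed

lemma rest_upd_ge:
  assumes "0 \<le> p" "p < 1/2" "finite I" "l \<in> I" "\<And>k. k \<in> I \<Longrightarrow> 0 \<le> w k"
  shows "p * (sum w I - w l) \<le> sum (upd p b y w) I - upd p b y w l"
proof -
  have "p * sum w (I - {l}) \<le> sum (upd p b y w) (I - {l})"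
    unfolding sum_distrib_left
  proof (rule sum_mono)
    fix k assume "k \<in> I - {l}"
    then have "p * w k \<le> (1 - p) * w k" using assms by (intro mult_right_mono) auto
    then show "p * w k \<le> upd p b y w k" by (simp add: upd_def mult.commute)
  qed
  then show ?thesis using assms by (simp add: sum_diff1)
qed

lemma rest_pos:
  fixes w :: "'a \<Rightarrow> real"
  assumes "finite I" "card I \<ge> 2" "l \<in> I" "\<And>k. k \<in> I \<Longrightarrow> 0 < w k"
  shows "0 < sum w I - w l"
proof -
  have "I - {l} \<noteq> {}" using assms(1-3)
    by (metis card.empty card_Suc_Diff1 numeral_2_eq_2 Suc_n_not_le_n)
  then have "0 < sum w (I - {l})" using assms by (intro sum_pos) auto
  then show ?thesis using assms by (simp add: sum_diff1)
qed

text \<open>Condition on each hypothesis \<open>l\<close>. Its rivals together answer like a mixture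
  of the two channel laws, so the expected gain in the log odds of \<open>l\<close> is largest when
  all rivals predict the opposite answer; it then equals the divergence between Bern(p) and
  Bern(1-p).\<close>

lemma llr_step:
  assumes p: "0 < p" "p < 1/2" and I: "finite I" "card I \<ge> 2" and w: "\<And>l. l \<in> I \<Longrightarrow> 0 < w l"
  shows "llr I w \<le> llr I (upd p b True w) + llr I (upd p b False w) + Dpq p * sum w I"
proof -
  have "w l * log 2 (sum w I - w l) - xlog (w l)
      \<le> (upd p b True w l * log 2 (sum (upd p b True w) I - upd p b True w l) - xlog (upd p b True w l))
      + (upd p b False w l * log 2 (sum (upd p b False w) I - upd p b False w l) - xlog (upd p b False w l))
      + Dpq p * w l" if l: "l \<in> I" for l
  proof -
    define c where "c = sum (upd p b (b l) w) I - upd p b (b l) w l"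
    define d where "d = sum (upd p b (\<not> b l) w) I - upd p b (\<not> b l) w l"
    have cd: "c + d = sum w I - w l"
      using sum_upd[of p b w I] upd_sum[of p b w l] by (cases "b l") (simp_all add: c_def d_def)
    have R: "0 < c + d" unfolding cd using I l w by (intro rest_pos) auto
    have "p * (c + d) \<le> c" "p * (c + d) \<le> d"
      unfolding cd unfolding c_def d_def using p I l w by (intro rest_upd_ge; force simp: less_imp_le)+
    note log_cross_entropy_le[OF p this R]
    then have *: "w l * log 2 (c + d)
        \<le> w l * ((1 - p) * log 2 c + p * log 2 d - p * log 2 (1 - p) - (1 - p) * log 2 p)"
      using w[OF l] by (intro mult_left_mono) auto
    have "xlog (w l * (1 - p)) = (1 - p) * xlog (w l) + w l * ((1 - p) * log 2 (1 - p))"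
      "xlog (w l * p) = p * xlog (w l) + w l * (p * log 2 p)"
      using w[OF l] p by (simp_all add: xlog_mult) (simp_all add: xlog_def)
    then have "w l * log 2 (c + d) - xlog (w l)
      \<le> (w l * (1 - p) * log 2 c - xlog (w l * (1 - p))) + (w l * p * log 2 d - xlog (w l * p)) + Dpq p * w l"
      using * p by (simp add: Dpq_def log_divide algebra_simps)
    then show ?thesis
      by (cases "b l") (simp_all add: cd[symmetric] c_def d_def upd_def)
  qed
  then have "llr I w \<le> (\<Sum>l\<in>I. (upd p b True w l * log 2 (sum (upd p b True w) I - upd p b True w l) - xlog (upd p b True w l))
      + (upd p b False w l * log 2 (sum (upd p b False w) I - upd p b False w l) - xlog (upd p b False w l))
      + Dpq p * w l)"
    unfolding llr_def by (rule sum_mono)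
  then show ?thesis by (simp add: llr_def sum.distrib sum_distrib_left)
qed

subsection \<open>The two-phase potential\<close>

text \<open>The tangent of ln at 2 has slope 1/2 \<le> ln 2, which absorbs the change of base; the
  tangent at 1 would be too steep.\<close>

lemma log2_le_self: "0 < x \<Longrightarrow> log 2 x \<le> (x::real)"
proof -
  assume x: "0 < x"
  have "ln (x / 2) \<le> x / 2 - 1" using x by (intro ln_le_minus_one) simp
  then have "ln x \<le> x / 2" using x ln_le_minus_one[of 2] by (simp add: ln_div)
  also have "\<dots> \<le> x * ln 2" using x ln2_ge_two_thirds by (simp add: field_simps)
  finally show "log 2 x \<le> x" by (simp add: log_def field_simps)
qed

text \<open>Gibbs' inequality against a fair bit. Strictness of one of its two terms suffices, and
  it comes from 1/(2p) being different from 1.\<close>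

lemma H2_less_1:
  assumes "0 \<le> p" "p < 1/2"
  shows "H2 p < 1"
proof (cases "p = 0")
  case False
  then have p: "0 < p" using assms by simp
  have 1: "ln (1 / (2 * p)) < 1 / (2 * p) - 1"
  proof -
    have "1 / (2 * p) \<noteq> 1" using assms p by (simp add: field_simps)
    then have "ln (1 / (2 * p)) \<noteq> 1 / (2 * p) - 1"
      using p ln_eq_minus_one[of "1 / (2 * p)"] by auto
    moreover have "ln (1 / (2 * p)) \<le> 1 / (2 * p) - 1" using p by (intro ln_le_minus_one) simp
    ultimately show ?thesis by simp
  qed
  have 2: "ln (1 / (2 * (1 - p))) \<le> 1 / (2 * (1 - p)) - 1" using assms by (intro ln_le_minus_one) simp
  have "p * ln (1 / (2 * p)) < p * (1 / (2 * p) - 1)" using 1 p by (rule mult_strict_left_mono)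
  moreover have "(1 - p) * ln (1 / (2 * (1 - p))) \<le> (1 - p) * (1 / (2 * (1 - p)) - 1)"
    using 2 assms by (intro mult_left_mono) auto
  moreover have "p * (1 / (2 * p) - 1) + (1 - p) * (1 / (2 * (1 - p)) - 1) = 0"
    using assms p by (simp add: right_diff_distrib)
  ultimately have S: "p * ln (1 / (2 * p)) + (1 - p) * ln (1 / (2 * (1 - p))) < 0" by linarith
  have "ln (1 / (2 * p)) = - ln 2 - ln p" "ln (1 / (2 * (1 - p))) = - ln 2 - ln (1 - p)"
    using assms p by (simp_all add: ln_div ln_mult del: right_diff_distrib_numeral)
  then have "p * (- ln 2 - ln p) + (1 - p) * (- ln 2 - ln (1 - p)) < 0" using S by (simp only:)
  then have "- p * ln p - (1 - p) * ln (1 - p) < ln 2" by (simp add: algebra_simps)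
  moreover have "H2 p = (- p * ln p - (1 - p) * ln (1 - p)) / ln 2"
    by (simp add: H2_def log_def diff_divide_distrib)
  ultimately show ?thesis by (simp add: divide_less_eq)
qed (simp add: H2_def)

lemma Dpq_pos:
  assumes "0 < p" "p < 1/2"
  shows "0 < Dpq p"
proof -
  have "Dpq p = (1 - 2 * p) * log 2 ((1 - p) / p)"
    using assms by (simp add: Dpq_def log_divide algebra_simps)
  moreover have "0 < log 2 ((1 - p) / p)" using assms by (simp add: less_divide_eq)
  ultimately show ?thesis using assms by simp
qed

lemma ent_nonneg:
  assumes "finite I" "\<And>l. l \<in> I \<Longrightarrow> 0 < w l"
  shows "0 \<le> ent I w"
proof -
  have "(\<Sum>l\<in>I. xlog (w l)) \<le> (\<Sum>l\<in>I. w l * log 2 (sum w I))"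
  proof (rule sum_mono)
    fix l assume l: "l \<in> I"
    have "w l \<le> sum w I" using assms l by (intro member_le_sum) (auto simp: less_imp_le)
    then have "log 2 (w l) \<le> log 2 (sum w I)" using assms(2)[OF l] by simp
    then show "xlog (w l) \<le> w l * log 2 (sum w I)"
      using assms(2)[OF l] by (simp add: xlog_def)
  qed
  then show ?thesis by (simp add: ent_def xlog_def sum_distrib_right[symmetric])
qed

text \<open>The subtracted terms are \<open>w l\<close> times minus the logarithm of the share held
  by the rivals of \<open>l\<close>. They are nonnegative, and every comparison of
  \<open>llr\<close> with \<open>ent\<close> is read off from this form.\<close>

lemma llr_eq: "llr I w = ent I w - (\<Sum>l\<in>I. w l * (log 2 (sum w I) - log 2 (sum w I - w l)))"
  by (simp add: llr_def ent_def xlog_def sum_subtractf right_diff_distrib sum_distrib_right[symmetric])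

lemma llr_gap_nonneg:
  assumes "finite I" "card I \<ge> 2" "\<And>l. l \<in> I \<Longrightarrow> 0 < w l" "l \<in> I"
  shows "0 \<le> w l * (log 2 (sum w I) - log 2 (sum w I - w l))"
proof -
  have "0 < sum w I - w l" using assms by (intro rest_pos) auto
  then have "log 2 (sum w I - w l) \<le> log 2 (sum w I)" using assms(3)[OF assms(4)] by simp
  then show ?thesis using assms(3)[OF assms(4)] by simp
qed

lemma llr_le_ent:
  assumes "finite I" "card I \<ge> 2" "\<And>l. l \<in> I \<Longrightarrow> 0 < w l"
  shows "llr I w \<le> ent I w"
proof -
  have "0 \<le> (\<Sum>l\<in>I. w l * (log 2 (sum w I) - log 2 (sum w I - w l)))"
    by (intro sum_nonneg llr_gap_nonneg assms)
  then show ?thesis by (simp add: llr_eq)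
qed

text \<open>This explains the threshold 1/L: a residual share of at most 1/L, times a log
  cardinality of at most L, adds only one bit to the one bit already present in
  \<open>fano\<close>.\<close>

lemma ent_le_decided:
  assumes "finite I" "\<And>l. l \<in> I \<Longrightarrow> 0 < w l" "l \<in> I" "log 2 (card I) \<le> L" "0 < L"
    and "sum w I - w l \<le> sum w I / L"
  shows "ent I w \<le> 2 * sum w I"
proof -
  have w: "0 \<le> w k" if "k \<in> I" for k using assms(2)[OF that] by simp
  have "w l \<le> sum w I" using assms(1,3) w by (intro member_le_sum) auto
  moreover have "1 \<le> card I" using assms(1,3) by (auto simp: Suc_le_eq card_gt_0_iff)
  ultimately have "(sum w I - w l) * log 2 (card I) \<le> (sum w I / L) * L"
    using assms by (intro mult_mono) (auto simp: sum_nonneg w)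
  then have "(sum w I - w l) * log 2 (card I) \<le> sum w I" using assms(5) by simp
  then show ?thesis using fano[OF assms(1) _ assms(3), of w] w by simp
qed

text \<open>Phase 2 is entered once some hypothesis carries posterior mass at least \<open>1 - 1/L\<close>. The offset \<open>switch\<close> lifts
  \<open>llr\<close> above the entropy term at every posterior reachable from phase 1 in one query, which is what
  makes the glued potential lose at most \<open>1\<close> per query.\<close>
definition switch :: "real \<Rightarrow> real \<Rightarrow> real" where
  "switch p L = 2 / (1 - H2 p) + (log 2 (1 / p) + log 2 L) / Dpq p"

definition decided :: "real \<Rightarrow> 'a set \<Rightarrow> ('a \<Rightarrow> real) \<Rightarrow> bool" where
  "decided L I w \<longleftrightarrow> (\<exists>l\<in>I. sum w I - w l \<le> sum w I / L)"

definition pot :: "real \<Rightarrow> real \<Rightarrow> 'a set \<Rightarrow> ('a \<Rightarrow> real) \<Rightarrow> real" where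
  "pot p L I w = (let f = llr I w / Dpq p + switch p L * sum w I in
     if decided L I w then f else max (ent I w / (1 - H2 p)) f)"

lemma pot_ge_llr: "llr I w / Dpq p + switch p L * sum w I \<le> pot p L I w"
  by (simp add: pot_def Let_def)

text \<open>The hypothesis on \<open>R\<close> holds after one query from an undecided state, since a response shrinks
  the remaining mass by a factor of at least \<open>p\<close>.\<close>
lemma pot_ge_ent:
  assumes p: "0 < p" "p < 1/2" and I: "finite I" "card I \<ge> 2" and w: "\<And>l. l \<in> I \<Longrightarrow> 0 < w l"
    and L: "log 2 (card I) \<le> L" "2 < L"
    and R: "\<And>l. l \<in> I \<Longrightarrow> p / L * sum w I \<le> sum w I - w l"
  shows "ent I w / (1 - H2 p) \<le> pot p L I w"
proof (cases "decided L I w")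
  case True
  then obtain l where l: "l \<in> I" "sum w I - w l \<le> sum w I / L" by (auto simp: decided_def)
  have E: "0 \<le> ent I w" "ent I w \<le> 2 * sum w I"
    using ent_nonneg[OF I(1), of w] ent_le_decided[OF I(1) _ l(1) L(1) _ l(2)] w L by auto
  have Z: "0 < sum w I" using l w I by (intro sum_pos) auto
  have C: "0 < 1 - H2 p" "0 < Dpq p" using H2_less_1[of p] Dpq_pos[of p] p by auto
  \<comment> \<open>By \<open>R\<close> no posterior mass exceeds 1 - p/L, so each gap in
    \<open>llr_eq\<close> is at most log (L/p). The second summand of \<open>switch\<close> pays for
    these gaps, the first for the at most two bits of entropy in a decided state.\<close>
  have "w k * (log 2 (sum w I) - log 2 (sum w I - w k)) \<le> w k * (log 2 (1 / p) + log 2 L)" if k: "k \<in> I" for k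
  proof -
    have "log 2 (p / L * sum w I) \<le> log 2 (sum w I - w k)"
      using R[OF k] p L Z rest_pos[OF I k, of w] w by (subst log_le_cancel_iff) auto
    also have "log 2 (p / L * sum w I) = log 2 (sum w I) - (log 2 (1 / p) + log 2 L)"
      using p L Z by (simp add: log_mult log_divide)
    finally show ?thesis using w[OF k] by (intro mult_left_mono) auto
  qed
  then have "(\<Sum>k\<in>I. w k * (log 2 (sum w I) - log 2 (sum w I - w k))) \<le> (\<Sum>k\<in>I. w k * (log 2 (1 / p) + log 2 L))"
    by (rule sum_mono)
  then have "- (sum w I * (log 2 (1 / p) + log 2 L)) \<le> llr I w"
    using E by (simp add: llr_eq sum_distrib_right)
  then have "- (sum w I * (log 2 (1 / p) + log 2 L)) / Dpq p \<le> llr I w / Dpq p"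
    using C by (intro divide_right_mono) auto
  moreover have "ent I w / (1 - H2 p) \<le> 2 * sum w I / (1 - H2 p)"
    using E C by (intro divide_right_mono) auto
  ultimately have "ent I w / (1 - H2 p) \<le> llr I w / Dpq p + switch p L * sum w I"
    by (simp add: switch_def divide_inverse algebra_simps)
  then show ?thesis using pot_ge_llr by (rule order_trans)
qed (simp add: pot_def Let_def)

text \<open>The log-odds branch is a lower bound of \<open>pot\<close> everywhere, so its one-step
  inequality always carries over; this settles decided states. In an undecided state the entropy
  branch must be dominated at both successors as well, even if they are decided, which is what
  \<open>pot_ge_ent\<close> provides.\<close>

lemma pot_step:
  assumes p: "0 < p" "p < 1/2" and I: "finite I" "card I \<ge> 2" and w: "\<And>l. l \<in> I \<Longrightarrow> 0 < w l"
    and L: "log 2 (card I) \<le> L" "2 < L"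
  shows "pot p L I w \<le> pot p L I (upd p b True w) + pot p L I (upd p b False w) + sum w I"
proof -
  let ?T = "upd p b True w" and ?F = "upd p b False w"
  define f1 where "f1 w = ent I w / (1 - H2 p)" for w
  define f2 where "f2 w = llr I w / Dpq p + switch p L * sum w I" for w
  have C: "0 < 1 - H2 p" "0 < Dpq p" using H2_less_1[of p] Dpq_pos[of p] p by auto
  have "ent I w / (1 - H2 p) \<le> (ent I ?T + ent I ?F + (1 - H2 p) * sum w I) / (1 - H2 p)"
    using C p w by (intro divide_right_mono ent_step) (auto simp: less_imp_le)
  then have 1: "f1 w \<le> f1 ?T + f1 ?F + sum w I" using C by (simp add: f1_def add_divide_distrib)
  have "llr I w / Dpq p \<le> (llr I ?T + llr I ?F + Dpq p * sum w I) / Dpq p"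
    using C p w I by (intro divide_right_mono llr_step) auto
  moreover have "switch p L * sum w I = switch p L * sum ?T I + switch p L * sum ?F I"
    by (simp add: sum_upd distrib_left[symmetric])
  ultimately have 2: "f2 w \<le> f2 ?T + f2 ?F + sum w I" using C by (simp add: f2_def add_divide_distrib)
  have pot2: "f2 v \<le> pot p L I v" for v unfolding f2_def by (rule pot_ge_llr)
  show ?thesis
  proof (cases "decided L I w")
    case True
    then have "pot p L I w = f2 w" by (simp add: pot_def f2_def)
    then show ?thesis using 2 pot2[of ?T] pot2[of ?F] by linarith
  next
    case False
    have "f1 (upd p b y w) \<le> pot p L I (upd p b y w)" for y
      unfolding f1_def
    proof (rule pot_ge_ent[OF p I _ L])
      fix l assume l: "l \<in> I"
      show "0 < upd p b y w l" using p w[OF l] by (intro upd_pos) auto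
      have "sum (upd p b y w) I \<le> sum w I"
        using p w by (intro sum_mono) (auto simp: upd_def mult_le_cancel_left1 dest!: less_imp_le)
      then have "p / L * sum (upd p b y w) I \<le> p / L * sum w I"
        using p L by (intro mult_left_mono) auto
      also have "\<dots> = p * (sum w I / L)" by simp
      also have "\<dots> \<le> p * (sum w I - w l)"
        using False l p by (intro mult_left_mono) (auto simp: decided_def not_le less_imp_le)
      also have "\<dots> \<le> sum (upd p b y w) I - upd p b y w l"
        using p I l w by (intro rest_upd_ge) (auto simp: less_imp_le)
      finally show "p / L * sum (upd p b y w) I \<le> sum (upd p b y w) I - upd p b y w l" .
    qed
    then have "f1 w \<le> pot p L I ?T + pot p L I ?F + sum w I"
      using 1 by (smt (verit))
    moreover have "f2 w \<le> pot p L I ?T + pot p L I ?F + sum w I"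
      using 2 pot2[of ?T] pot2[of ?F] by linarith
    moreover have "pot p L I w = max (f1 w) (f2 w)" using False by (simp add: pot_def f1_def f2_def)
    ultimately show ?thesis by simp
  qed
qed

text \<open>If the rivals of \<open>l\<close> hold the share \<open>r\<close>, the log odds are
  about log (1/r). The bound log (n r) \<le> n r replaces this by log n - n r, which is linear in
  the residual mass; the gaps of the other hypotheses are nonnegative and are dropped.\<close>

lemma llr_decided_le:
  fixes n :: real
  assumes I: "finite I" "card I \<ge> 2" and w: "\<And>l. l \<in> I \<Longrightarrow> 0 < w l"
    and L: "log 2 (card I) \<le> log 2 n" "2 < log 2 n" and n: "0 < n"
    and l: "l \<in> I" "sum w I - w l \<le> sum w I / log 2 n"
  shows "llr I w \<le> (3 - log 2 n) * sum w I + n * (sum w I - w l)"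
proof -
  define Z where "Z = sum w I"
  define r where "r = (Z - w l) / Z"
  have Z: "0 < Z" unfolding Z_def using l w I by (intro sum_pos) auto
  have R: "0 < sum w I - w l" using I l w by (intro rest_pos) auto
  have r: "0 < r" unfolding r_def Z_def using R Z by (intro divide_pos_pos) (auto simp: Z_def)
  have wl: "w l = Z * (1 - r)" using Z by (simp add: r_def field_simps)
  have r1: "r \<le> 1" using Z w[OF l(1)] by (simp add: r_def)
  have "log 2 (1 / r) \<le> 1 / r" using r by (intro log2_le_self) auto
  then have "r * log 2 (1 / r) \<le> r * (1 / r)" using r by (intro mult_left_mono) auto
  then have a: "- (r * log 2 r) \<le> 1" using r by (simp add: log_divide)
  have "log 2 (n * r) \<le> n * r" using n r by (intro log2_le_self) auto
  then have b: "log 2 n + log 2 r \<le> n * r" using n r by (simp add: log_mult)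
  have "log 2 Z - log 2 (Z - w l) = - log 2 r"
    unfolding r_def using Z R by (subst log_divide) (auto simp: Z_def)
  then have "w l * (log 2 Z - log 2 (Z - w l)) = w l * (- log 2 r)" by simp
  also have "\<dots> = Z * (- log 2 r + r * log 2 r)"
    unfolding wl by (simp add: algebra_simps)
  also have "\<dots> \<ge> Z * (log 2 n - n * r - 1)"
    using Z a b by (intro mult_left_mono) auto
  also have "Z * (log 2 n - n * r - 1) = Z * (log 2 n - 1) - n * (Z - w l)"
    by (simp add: wl algebra_simps)
  finally have "Z * (log 2 n - 1) - n * (Z - w l) \<le> w l * (log 2 Z - log 2 (Z - w l))" .
  also have "\<dots> \<le> (\<Sum>l\<in>I. w l * (log 2 Z - log 2 (Z - w l)))"
    unfolding Z_def using llr_gap_nonneg[OF I, of w] w l I by (intro member_le_sum) auto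
  finally have "llr I w \<le> ent I w - (Z * (log 2 n - 1) - n * (Z - w l))"
    by (simp add: llr_eq Z_def)
  moreover have "ent I w \<le> 2 * Z"
    unfolding Z_def using ent_le_decided[OF I(1) _ l(1) L(1) _ l(2)] w L by simp
  ultimately show ?thesis by (simp add: Z_def algebra_simps)
qed

text \<open>For output \<open>l\<close>, the quantity \<open>sum w I - w l\<close> is the
  unnormalised error probability. In a decided state \<open>llr_decided_le\<close> applies. In an
  undecided one the error share is at least 1/L, so even the crude entropy bound L per unit of mass
  can be charged to the error, at the price of a factor L^2.\<close>

lemma pot_terminal:
  fixes n :: real
  assumes p: "0 < p" "p < 1/2" and I: "finite I" "card I \<ge> 2" and w: "\<And>l. l \<in> I \<Longrightarrow> 0 < w l"
    and L: "log 2 (card I) \<le> log 2 n" "2 < log 2 n" and n: "0 < n"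
    and l: "l \<in> I"
  defines "C \<equiv> 1 - H2 p" and "D \<equiv> Dpq p"
  shows "pot p (log 2 n) I w \<le> (switch p (log 2 n) + 3 / D - log 2 n / D) * sum w I
     + (n / D + (log 2 n)^2 * (1 / C + 2 / D)) * (sum w I - w l)"
proof -
  define Z where "Z = sum w I"
  define L' where "L' = log 2 n"
  define R where "R = Z - w l"
  have C: "0 < C" "0 < D" using H2_less_1[of p] Dpq_pos[of p] p by (auto simp: C_def D_def)
  have Z: "0 < Z" unfolding Z_def using l w I by (intro sum_pos) auto
  have R0: "0 < R" using rest_pos[OF I l, of w] w by (simp add: R_def Z_def)
  have L2: "2 < L'" using L by (simp add: L'_def)
  show ?thesis
  proof (cases "decided L' I w")
    case True
    then obtain k where k: "k \<in> I" "Z - w k \<le> Z / L'" by (auto simp: decided_def Z_def)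
    have "llr I w \<le> (3 - L') * Z + n * (Z - w k)"
      unfolding Z_def L'_def using k by (intro llr_decided_le I w L n) (auto simp: Z_def L'_def)
    \<comment> \<open>If the output \<open>l\<close> is not the dominant \<open>k\<close>, its error
      mass \<open>R\<close> is at least \<open>w k\<close>, hence at least half of \<open>Z\<close>
      since L > 2, while the residual mass of \<open>k\<close> is at most half.\<close>
    also have "Z - w k \<le> R"
    proof (cases "k = l")
      case False
      have "sum w {k, l} \<le> Z" unfolding Z_def using I k l w by (intro sum_mono2) (auto simp: less_imp_le)
      then have "w k + w l \<le> Z" using False by simp
      moreover have "Z / L' \<le> Z / 2" using Z L2 by (intro divide_left_mono) auto
      ultimately show ?thesis unfolding R_def using k(2) by linarith
    qed (simp add: R_def)
    finally have "llr I w \<le> (3 - L') * Z + n * R" using n by simp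
    then have "llr I w / D \<le> ((3 - L') * Z + n * R) / D" using C by (intro divide_right_mono) auto
    moreover have "0 \<le> L'^2 * (1 / C + 2 / D) * R" using C R0 by simp
    moreover have "pot p L' I w = llr I w / D + switch p L' * Z"
      using True by (simp add: pot_def D_def Z_def)
    ultimately show ?thesis
      unfolding Z_def[symmetric] L'_def[symmetric] R_def[symmetric]
      by (simp add: algebra_simps add_divide_distrib diff_divide_distrib)
  next
    case False
    then have "Z / L' \<le> R" using l by (auto simp: decided_def R_def Z_def not_le less_imp_le)
    then have ZR: "Z \<le> L' * R" using L2 by (simp add: field_simps)
    have w0: "0 \<le> w k" if "k \<in> I" for k using w[OF that] by simp
    have "ent I w \<le> Z * log 2 (card I)" unfolding Z_def using I w0 by (intro ent_le) auto
    also have "\<dots> \<le> Z * L'" using Z L by (intro mult_left_mono) (auto simp: L'_def)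
    finally have E: "ent I w \<le> Z * L'" .
    have "ent I w / C \<le> Z * L' / C" "llr I w / D \<le> Z * L' / D"
      using E llr_le_ent[OF I, of w] w C by (intro divide_right_mono; simp)+
    moreover have "0 \<le> Z * L' / C" "0 \<le> Z * L' / D" using Z L2 C by auto
    moreover have "0 \<le> switch p L' * Z"
    proof -
      have "0 \<le> switch p L'" unfolding switch_def
        using C L2 p by (intro add_nonneg_nonneg divide_nonneg_nonneg) (auto simp: C_def D_def)
      then show ?thesis using Z by simp
    qed
    moreover have "pot p L' I w = max (ent I w / C) (llr I w / D + switch p L' * Z)"
      using False by (simp add: pot_def D_def Z_def C_def)
    ultimately have "pot p L' I w \<le> switch p L' * Z + Z * L' / C + Z * L' / D"
      by simp
    moreover have "Z * (L' * (1 / C + 2 / D)) \<le> L' * R * (L' * (1 / C + 2 / D))"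
      using ZR L2 C by (intro mult_right_mono) auto
    moreover have "0 \<le> n / D * R" "0 \<le> Z / D" using n C R0 Z by auto
    ultimately show ?thesis
      unfolding Z_def[symmetric] L'_def[symmetric] R_def[symmetric]
      by (simp add: divide_inverse algebra_simps power2_eq_square)
  qed
qed

text \<open>A uniform prior on at least two points is undecided, as the residual share is at least
  1/2 and 1/L is smaller. So the potential starts on its entropy branch.\<close>

lemma pot_uniform:
  assumes I: "finite I" "card I \<ge> 2" and L: "2 < L"
  shows "log 2 (card I) / (1 - H2 p) \<le> pot p L I (\<lambda>_. 1 / card I)"
proof -
  have c: "0 < card I" using I by simp
  have "1 / L < 1 / 2" using L by simp
  moreover have "1 / real (card I) \<le> 1 / 2" using I by (simp add: field_simps)
  ultimately have "\<not> 1 - 1 / real (card I) \<le> 1 / L" by linarith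
  then have "\<not> decided L I (\<lambda>_. 1 / card I)" using c by (simp add: decided_def)
  moreover have "ent I (\<lambda>_. 1 / card I) = log 2 (card I)"
    using c by (simp add: ent_def xlog_def log_divide)
  ultimately show ?thesis by (simp add: pot_def Let_def)
qed

subsection \<open>Converse for a single noisy search\<close>

text \<open>\<open>reach\<close> splits into \<open>ask_weight\<close>, which is the same under every hypothesis, and a likelihood,
  which \<open>post\<close> multiplies into the prior.\<close>
fun ask_weight :: "strat \<Rightarrow> (nat \<times> bool) list \<Rightarrow> real" where
  "ask_weight s [] = 1"
| "ask_weight s ((j, y) # h) = ask_weight s h * pmf (s h) (Ask j)"

fun post :: "real \<Rightarrow> ('a \<Rightarrow> nat \<Rightarrow> bool) \<Rightarrow> ('a \<Rightarrow> real) \<Rightarrow> (nat \<times> bool) list \<Rightarrow> 'a \<Rightarrow> real" where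
  "post p b w [] = w"
| "post p b w ((j, y) # h) = upd p (\<lambda>l. b l j) y (post p b w h)"

lemma reach_eq: "reach p s (b l) h * w l = ask_weight s h * post p b w h l"
  by (induction p s "b l" h rule: reach.induct) (auto simp: upd_def)

lemma ask_weight_nonneg: "0 \<le> ask_weight s h"
  by (induction s h rule: ask_weight.induct) auto

lemma reach_nonneg: "0 \<le> p \<Longrightarrow> p \<le> 1 \<Longrightarrow> 0 \<le> reach p s b h"
  by (induction p s b h rule: reach.induct) auto

section \<open>Optional stopping along histories, one length at a time\<close>

lemma hists_0: "hists i 0 = {[]}"
  by (auto simp: hists_def)

lemma hists_Suc: "hists i (Suc k) = (\<lambda>(h, j, y). (j, y) # h) ` (hists i k \<times> {1..i} \<times> UNIV)"
proof (intro equalityI subsetI)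
  fix h assume "h \<in> hists i (Suc k)"
  then obtain j y h' where "h = (j, y) # h'" "h' \<in> hists i k" "j \<in> {1..i}"
    by (cases h) (auto simp: hists_def)
  then show "h \<in> (\<lambda>(h, j, y). (j, y) # h) ` (hists i k \<times> {1..i} \<times> UNIV)"
    by (intro image_eqI[of _ _ "(h', j, y)"]) auto
qed (auto simp: hists_def)

lemma sum_hists_Suc:
  "(\<Sum>h\<in>hists i (Suc k). F h) = (\<Sum>h\<in>hists i k. \<Sum>j\<in>{1..i}. F ((j, True) # h) + F ((j, False) # h) :: real)"
proof -
  have "(\<Sum>h\<in>hists i (Suc k). F h) = (\<Sum>(h, j, y)\<in>hists i k \<times> {1..i} \<times> UNIV. F ((j, y) # h))"
    unfolding hists_Suc by (subst sum.reindex) (auto simp: inj_on_def case_prod_unfold)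
  also have "\<dots> = (\<Sum>h\<in>hists i k. \<Sum>j\<in>{1..i}. \<Sum>y\<in>UNIV. F ((j, y) # h))"
    by (simp only: sum.cartesian_product)
  finally show ?thesis by (simp add: UNIV_bool add.commute)
qed

definition stop_now :: "nat \<Rightarrow> strat \<Rightarrow> (nat \<times> bool) list \<Rightarrow> real" where
  "stop_now i s h = (\<Sum>l\<in>{1..Suc i}. pmf (s h) (Stop l))"

lemma stop_or_ask:
  assumes "valid_strat i s"
  shows "stop_now i s h + (\<Sum>j\<in>{1..i}. pmf (s h) (Ask j)) = 1"
proof -
  have "1 = sum (pmf (s h)) (Stop ` {1..Suc i} \<union> Ask ` {1..i})"
    using assms by (intro sum_pmf_eq_1[symmetric]) (auto simp: valid_strat_def)
  also have "\<dots> = sum (pmf (s h)) (Stop ` {1..Suc i}) + sum (pmf (s h)) (Ask ` {1..i})"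
    by (intro sum.union_disjoint) auto
  also have "\<dots> = stop_now i s h + (\<Sum>j\<in>{1..i}. pmf (s h) (Ask j))"
    by (simp add: sum.reindex inj_on_def stop_now_def del: atLeastAtMost_insertL image_insert
        flip: image_Suc_lessThan)
  finally show ?thesis by simp
qed

text \<open>The one-query inequality is weighted by the chance of reaching \<open>h\<close> and
  asking \<open>j\<close>, then summed; the part of the run that stops at \<open>h\<close> keeps its
  potential. By homogeneity the posterior weights already contain the response
  probabilities.\<close>

lemma potential_hists_step:
  assumes s: "valid_strat i s"
    and step: "\<And>h j. g (post p b w h)
      \<le> g (post p b w ((j, True) # h)) + g (post p b w ((j, False) # h)) + c (post p b w h)"
  shows "(\<Sum>h\<in>hists i k. ask_weight s h * g (post p b w h))
    \<le> (\<Sum>h\<in>hists i k. ask_weight s h * stop_now i s h * g (post p b w h))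
      + (\<Sum>h\<in>hists i (Suc k). ask_weight s h * g (post p b w h))
      + (\<Sum>h\<in>hists i k. ask_weight s h * (1 - stop_now i s h) * c (post p b w h))"
proof -
  have "ask_weight s h * g (post p b w h) \<le> ask_weight s h * stop_now i s h * g (post p b w h)
     + (\<Sum>j\<in>{1..i}. ask_weight s ((j, True) # h) * g (post p b w ((j, True) # h))
         + ask_weight s ((j, False) # h) * g (post p b w ((j, False) # h)))
     + ask_weight s h * (1 - stop_now i s h) * c (post p b w h)" for h
  proof -
    let ?q = "\<lambda>j. ask_weight s h * pmf (s h) (Ask j)"
    have "(\<Sum>j\<in>{1..i}. ?q j * g (post p b w h)) \<le> (\<Sum>j\<in>{1..i}. ?q j *
      (g (post p b w ((j, True) # h)) + g (post p b w ((j, False) # h)) + c (post p b w h)))"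
      by (intro sum_mono mult_left_mono step mult_nonneg_nonneg ask_weight_nonneg pmf_nonneg)
    moreover have "(\<Sum>j\<in>{1..i}. ?q j) = ask_weight s h * (1 - stop_now i s h)"
      using stop_or_ask[OF s, of h] by (simp add: sum_distrib_left[symmetric])
    ultimately show ?thesis
      by (simp add: sum_distrib_right[symmetric] sum.distrib distrib_left) (simp add: algebra_simps)
  qed
  then show ?thesis
    unfolding sum_hists_Suc by (simp add: sum.distrib[symmetric] sum_mono)
qed

lemma mass_hists_step:
  assumes "valid_strat i s"
  shows "(\<Sum>h\<in>hists i k. ask_weight s h * sum (post p b w h) I)
    = (\<Sum>h\<in>hists i k. ask_weight s h * stop_now i s h * sum (post p b w h) I)
      + (\<Sum>h\<in>hists i (Suc k). ask_weight s h * sum (post p b w h) I)"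
proof -
  have "(\<Sum>h\<in>hists i (Suc k). ask_weight s h * sum (post p b w h) I)
      = (\<Sum>h\<in>hists i k. \<Sum>j\<in>{1..i}. ask_weight s h * pmf (s h) (Ask j) * sum (post p b w h) I)"
    unfolding sum_hists_Suc by (simp add: distrib_left[symmetric] sum_upd)
  also have "\<dots> = (\<Sum>h\<in>hists i k. ask_weight s h * (1 - stop_now i s h) * sum (post p b w h) I)"
  proof (rule sum.cong[OF refl])
    fix h
    show "(\<Sum>j\<in>{1..i}. ask_weight s h * pmf (s h) (Ask j) * sum (post p b w h) I)
        = ask_weight s h * (1 - stop_now i s h) * sum (post p b w h) I"
      using stop_or_ask[OF assms, of h]
      by (simp add: sum_distrib_left[symmetric] sum_distrib_right[symmetric])
  qed
  finally show ?thesis by (simp add: sum.distrib[symmetric] algebra_simps)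
qed

text \<open>Optional stopping truncated at depth \<open>N\<close>: the first sum is the truncated
  mean number of queries under the prior \<open>w\<close>, and \<open>B\<close> multiplies the
  probability of not having stopped correctly before depth \<open>N\<close>. The truncation keeps
  all sums finite.\<close>

lemma potential_bound:
  fixes w :: "nat \<Rightarrow> real"
  assumes s: "valid_strat i s"
    and step: "\<And>h j. g (post p b w h)
      \<le> g (post p b w ((j, True) # h)) + g (post p b w ((j, False) # h)) + sum (post p b w h) {1..Suc i}"
    and stop: "\<And>h l. l \<in> {1..Suc i} \<Longrightarrow> g (post p b w h) \<le> B * (sum (post p b w h) {1..Suc i} - post p b w h l)"
    and nn: "\<And>h l. l \<in> {1..Suc i} \<Longrightarrow> 0 \<le> post p b w h l"
    and B: "0 \<le> B" and w: "sum w {1..Suc i} = 1"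
  shows "g w \<le> (\<Sum>k<N. \<Sum>h\<in>hists i (Suc k). ask_weight s h * sum (post p b w h) {1..Suc i})
    + B * (1 - (\<Sum>k<N. \<Sum>h\<in>hists i k. \<Sum>l\<in>{1..Suc i}. ask_weight s h * pmf (s h) (Stop l) * post p b w h l))"
proof -
  define Z where "Z h = sum (post p b w h) {1..Suc i}" for h
  define G where "G h = g (post p b w h)" for h
  define M where "M k = (\<Sum>h\<in>hists i k. ask_weight s h * Z h)" for k
  define K where "K k = (\<Sum>h\<in>hists i k. \<Sum>l\<in>{1..Suc i}. ask_weight s h * pmf (s h) (Stop l) * post p b w h l)" for k
  have mass: "M k = (\<Sum>h\<in>hists i k. ask_weight s h * stop_now i s h * Z h) + M (Suc k)" for k
    unfolding M_def Z_def by (rule mass_hists_step[OF s])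
  have stopped: "(\<Sum>h\<in>hists i k. ask_weight s h * stop_now i s h * G h)
      \<le> B * (\<Sum>h\<in>hists i k. ask_weight s h * stop_now i s h * Z h) - B * K k" for k
  proof -
    have "ask_weight s h * stop_now i s h * G h
        \<le> B * (ask_weight s h * stop_now i s h * Z h) - B * (\<Sum>l\<in>{1..Suc i}. ask_weight s h * pmf (s h) (Stop l) * post p b w h l)" for h
    proof -
      have "(\<Sum>l\<in>{1..Suc i}. ask_weight s h * pmf (s h) (Stop l) * G h)
          \<le> (\<Sum>l\<in>{1..Suc i}. ask_weight s h * pmf (s h) (Stop l) * (B * (Z h - post p b w h l)))"
        unfolding G_def Z_def by (intro sum_mono mult_left_mono stop) (auto simp: ask_weight_nonneg)
      also have "\<dots> = (\<Sum>l\<in>{1..Suc i}. ask_weight s h * pmf (s h) (Stop l)) * (B * Z h)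
          - B * (\<Sum>l\<in>{1..Suc i}. ask_weight s h * pmf (s h) (Stop l) * post p b w h l)"
        unfolding sum_distrib_right sum_distrib_left sum_subtractf[symmetric]
        by (rule sum.cong) (auto simp: algebra_simps)
      finally show ?thesis
        unfolding stop_now_def sum_distrib_left[symmetric] sum_distrib_right[symmetric]
        by (simp only: mult.assoc mult.left_commute[of B])
    qed
    then show ?thesis
      unfolding K_def sum_distrib_left[of B] sum_subtractf[symmetric] by (intro sum_mono) (simp only: sum_distrib_left)
  qed
  have ask: "(\<Sum>h\<in>hists i k. ask_weight s h * (1 - stop_now i s h) * Z h) = M (Suc k)" for k
    using mass[of k] unfolding M_def by (simp add: sum_subtractf algebra_simps)
  \<comment> \<open>\<open>1 - M N\<close> is the mass stopped before depth \<open>N\<close>;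
    removing the correct stops \<open>K\<close> leaves the erroneous ones.\<close>
  have main: "g w \<le> (\<Sum>k<N. M (Suc k)) + B * (1 - M N - (\<Sum>k<N. K k)) + (\<Sum>h\<in>hists i N. ask_weight s h * G h)"
  proof (induction N)
    case 0
    show ?case using w by (simp add: hists_0 M_def G_def Z_def)
  next
    case (Suc N)
    have "(\<Sum>h\<in>hists i N. ask_weight s h * G h) \<le> (\<Sum>h\<in>hists i N. ask_weight s h * stop_now i s h * G h)
        + (\<Sum>h\<in>hists i (Suc N). ask_weight s h * G h) + M (Suc N)"
      using potential_hists_step[where g=g and c="\<lambda>v. sum v {1..Suc i}" and k=N, OF s step] ask[of N]
      unfolding G_def Z_def by simp
    also have "\<dots> \<le> B * (M N - M (Suc N)) - B * K N + (\<Sum>h\<in>hists i (Suc N). ask_weight s h * G h) + M (Suc N)"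
      using stopped[of N] mass[of N] by simp
    finally show ?case using Suc by (simp add: algebra_simps)
  qed
  \<comment> \<open>Runs still active at depth \<open>N\<close> are counted as errors; the terminal
    inequality for the arbitrary output 1 bounds their potential.\<close>
  have "(\<Sum>h\<in>hists i N. ask_weight s h * G h) \<le> (\<Sum>h\<in>hists i N. ask_weight s h * (B * Z h))"
  proof (intro sum_mono mult_left_mono ask_weight_nonneg)
    fix h
    have "G h \<le> B * (Z h - post p b w h 1)" unfolding G_def Z_def by (rule stop) simp
    also have "\<dots> \<le> B * Z h" using B nn[of 1 h] by (intro mult_left_mono) auto
    finally show "G h \<le> B * Z h" .
  qed
  also have "\<dots> = B * M N" by (simp add: M_def sum_distrib_left algebra_simps)
  finally show ?thesis using main unfolding M_def K_def Z_def by (simp add: algebra_simps)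
qed

section \<open>Output law of a search, and the converse for its worst position\<close>

lemma stopped_le_1:
  assumes p: "0 \<le> p" "p \<le> 1" and s: "valid_strat i s"
  shows "(\<Sum>k<N. \<Sum>h\<in>hists i k. reach p s b h * stop_now i s h) \<le> 1"
proof -
  \<comment> \<open>A family with a single hypothesis, indexed by \<open>unit\<close>, turns the
    posterior mass into \<open>reach\<close> itself, so \<open>mass_hists_step\<close> becomes
    conservation of probability under fixed true answers.\<close>
  have r: "reach p s b h = ask_weight s h * sum (post p (\<lambda>_::unit. b) (\<lambda>_. 1) h) UNIV" for h
    using reach_eq[of p s "\<lambda>_::unit. b" "()" h "\<lambda>_. 1"] by (simp add: UNIV_unit)
  have mass: "(\<Sum>h\<in>hists i k. reach p s b h)
      = (\<Sum>h\<in>hists i k. reach p s b h * stop_now i s h) + (\<Sum>h\<in>hists i (Suc k). reach p s b h)" for k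
    using mass_hists_step[OF s, of p "\<lambda>_::unit. b" "\<lambda>_. 1" UNIV k] by (simp add: r mult_ac)
  have "(\<Sum>k<N. \<Sum>h\<in>hists i k. reach p s b h * stop_now i s h) + (\<Sum>h\<in>hists i N. reach p s b h) = 1"
  proof (induction N)
    case (Suc N)
    then show ?case using mass[of N] unfolding sum.lessThan_Suc by linarith
  qed (simp add: hists_0)
  moreover have "0 \<le> (\<Sum>h\<in>hists i N. reach p s b h)" using p by (intro sum_nonneg reach_nonneg)
  ultimately show ?thesis by simp
qed

lemma pmf_Stop_outside:
  assumes "valid_strat i s" "l \<notin> {1..Suc i}"
  shows "pmf (s h) (Stop l) = 0"
proof -
  have "Stop l \<notin> set_pmf (s h)" using assms unfolding valid_strat_def by fastforce
  then show ?thesis by (simp add: set_pmf_iff)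
qed

lemma stop_prob_outside:
  assumes "valid_strat i s" "l \<notin> {1..Suc i}"
  shows "stop_prob p s b i l = 0"
  by (simp only: stop_prob_def pmf_Stop_outside[OF assms] mult_zero_right sum.neutral_const suminf_zero)

lemma summable_stop_prob:
  assumes p: "0 \<le> p" "p \<le> 1" and s: "valid_strat i s"
  shows "summable (\<lambda>k. \<Sum>h\<in>hists i k. reach p s b h * pmf (s h) (Stop l))"
proof (cases "l \<in> {1..Suc i}")
  case True
  show ?thesis
  proof (rule bounded_imp_summable)
    fix n
    have "(\<Sum>k\<le>n. \<Sum>h\<in>hists i k. reach p s b h * pmf (s h) (Stop l))
        \<le> (\<Sum>k\<le>n. \<Sum>h\<in>hists i k. reach p s b h * stop_now i s h)"
      unfolding stop_now_def using True p
      by (intro sum_mono mult_left_mono reach_nonneg member_le_sum) auto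
    also have "\<dots> \<le> 1" using stopped_le_1[OF p s, of b "Suc n"] by (simp add: lessThan_Suc_atMost)
    finally show "(\<Sum>k\<le>n. \<Sum>h\<in>hists i k. reach p s b h * pmf (s h) (Stop l)) \<le> 1" .
  qed (use p in \<open>auto intro!: sum_nonneg mult_nonneg_nonneg reach_nonneg\<close>)
next
  case False
  then show ?thesis by (simp only: pmf_Stop_outside[OF s False] mult_zero_right sum.neutral_const summable_zero)
qed

lemma stop_prob_nonneg:
  assumes p: "0 \<le> p" "p \<le> 1" and s: "valid_strat i s"
  shows "0 \<le> stop_prob p s b i l"
  unfolding stop_prob_def using p
  by (intro suminf_nonneg summable_stop_prob[OF p s] sum_nonneg mult_nonneg_nonneg reach_nonneg) auto

lemma sum_stop_prob_le_1:
  assumes p: "0 \<le> p" "p \<le> 1" and s: "valid_strat i s"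
  shows "(\<Sum>l\<in>{1..Suc i}. stop_prob p s b i l) \<le> 1"
proof -
  have eq: "(\<Sum>l\<in>{1..Suc i}. \<Sum>h\<in>hists i k. reach p s b h * pmf (s h) (Stop l))
      = (\<Sum>h\<in>hists i k. reach p s b h * stop_now i s h)" for k
    by (subst sum.swap) (simp add: stop_now_def sum_distrib_left del: sum.cl_ivl_Suc)
  have "(\<Sum>l\<in>{1..Suc i}. stop_prob p s b i l)
      = (\<Sum>k. \<Sum>l\<in>{1..Suc i}. \<Sum>h\<in>hists i k. reach p s b h * pmf (s h) (Stop l))"
    unfolding stop_prob_def by (rule suminf_sum[symmetric]) (rule summable_stop_prob[OF p s])
  also have "\<dots> \<le> 1"
  proof (rule suminf_le_const)
    show "summable (\<lambda>k. \<Sum>l\<in>{1..Suc i}. \<Sum>h\<in>hists i k. reach p s b h * pmf (s h) (Stop l))"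
      by (intro summable_sum summable_stop_prob[OF p s])
  qed (simp only: eq stopped_le_1[OF p s])
  finally show ?thesis .
qed

text \<open>\<open>embed_spmf\<close> carries the prescribed weights once their total is known to be
  at most 1; validity of the strategy reduces that total to the positions
  \<open>{1..Suc i}\<close>.\<close>

lemma spmf_search_out:
  assumes p: "0 \<le> p" "p \<le> 1" and s: "valid_strat i s"
  shows "spmf (search_out p s b i) l = stop_prob p s b i l"
proof -
  have "(\<integral>\<^sup>+ l. ennreal (stop_prob p s b i l) \<partial>count_space UNIV) = (\<Sum>l\<in>{1..Suc i}. ennreal (stop_prob p s b i l))"
    by (rule nn_integral_count_space') (simp_all only: stop_prob_outside[OF s] not_False_eq_True ennreal_0 finite_atLeastAtMost subset_UNIV)
  also have "\<dots> = ennreal (\<Sum>l\<in>{1..Suc i}. stop_prob p s b i l)"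
    by (rule sum_ennreal) (rule stop_prob_nonneg[OF p s])
  also have "\<dots> \<le> 1" using sum_stop_prob_le_1[OF p s, of b] by (simp only: ennreal_le_1)
  finally show ?thesis
    unfolding search_out_def by (simp add: spmf_embed_spmf stop_prob_nonneg[OF p s])
qed

lemma partial_queries_le:
  assumes p: "0 \<le> p" "p \<le> 1"
  shows "ennreal (\<Sum>k<N. \<Sum>h\<in>hists i (Suc k). reach p s b h) \<le> exp_queries p s b i"
proof -
  have "ennreal (\<Sum>k<N. \<Sum>h\<in>hists i (Suc k). reach p s b h)
      = (\<Sum>k<N. ennreal (\<Sum>h\<in>hists i (Suc k). reach p s b h))"
    using p by (intro sum_ennreal[symmetric] sum_nonneg reach_nonneg)
  also have "\<dots> \<le> exp_queries p s b i"
    unfolding exp_queries_def by (intro sum_le_suminf) auto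
  finally show ?thesis .
qed

text \<open>Under a uniform prior the potential bound controls the query count averaged over
  positions, so some position must reach it. Arguing by contradiction makes every expected query
  count finite, hence representable by the real numbers \<open>T l\<close>; the truncation depth
  then tends to infinity.\<close>

lemma search_converse:
  fixes i :: nat
  defines "w \<equiv> (\<lambda>_. 1 / real (Suc i))"
  assumes p: "0 \<le> p" "p \<le> 1" and s: "valid_strat i s"
    and step: "\<And>h j. g (post p b w h)
      \<le> g (post p b w ((j, True) # h)) + g (post p b w ((j, False) # h)) + sum (post p b w h) {1..Suc i}"
    and stop: "\<And>h l. l \<in> {1..Suc i} \<Longrightarrow> g (post p b w h) \<le> B * (sum (post p b w h) {1..Suc i} - post p b w h l)"
    and B: "0 \<le> B"
    and E: "\<And>l. l \<in> {1..Suc i} \<Longrightarrow> 1 - E \<le> stop_prob p s (b l) i l"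
  shows "\<exists>l\<in>{1..Suc i}. ennreal (g w - B * E) \<le> exp_queries p s (b l) i"
proof (rule ccontr)
  define T where "T l = enn2real (exp_queries p s (b l) i)" for l
  define m where "m = real (Suc i)"
  have m: "0 < m" by (simp add: m_def)
  assume "\<not> ?thesis"
  then have less: "exp_queries p s (b l) i < ennreal (g w - B * E)" if "l \<in> {1..Suc i}" for l
    using that by (auto simp: not_le)
  then have T: "exp_queries p s (b l) i = ennreal (T l)" if "l \<in> {1..Suc i}" for l
    unfolding T_def using that by (metis ennreal_enn2real_if ennreal_less_top infinity_ennreal_def not_less_iff_gr_or_eq order_less_trans)
  have T0: "0 \<le> T l" for l by (simp add: T_def)
  have nn: "0 \<le> post p b w h l" for h l
    using p by (induction h) (auto simp: w_def upd_nonneg)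
  have queries: "(\<Sum>k<N. \<Sum>h\<in>hists i (Suc k). ask_weight s h * sum (post p b w h) {1..Suc i}) \<le> (\<Sum>l\<in>{1..Suc i}. T l) / m" for N
  proof -
    have "(\<Sum>k<N. \<Sum>h\<in>hists i (Suc k). ask_weight s h * sum (post p b w h) {1..Suc i})
        = (\<Sum>k<N. \<Sum>h\<in>hists i (Suc k). \<Sum>l\<in>{1..Suc i}. reach p s (b l) h / m)"
      unfolding sum_distrib_left by (simp only: reach_eq[symmetric]) (simp add: w_def m_def)
    also have "\<dots> = (\<Sum>k<N. \<Sum>l\<in>{1..Suc i}. \<Sum>h\<in>hists i (Suc k). reach p s (b l) h / m)"
      by (intro sum.cong refl sum.swap)
    also have "\<dots> = (\<Sum>l\<in>{1..Suc i}. \<Sum>k<N. \<Sum>h\<in>hists i (Suc k). reach p s (b l) h / m)"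
      by (rule sum.swap)
    also have "\<dots> = (\<Sum>l\<in>{1..Suc i}. (\<Sum>k<N. \<Sum>h\<in>hists i (Suc k). reach p s (b l) h) / m)"
      unfolding sum_divide_distrib ..
    also have "\<dots> \<le> (\<Sum>l\<in>{1..Suc i}. T l / m)"
    proof (intro sum_mono divide_right_mono)
      fix l assume l: "l \<in> {1..Suc i}"
      show "(\<Sum>k<N. \<Sum>h\<in>hists i (Suc k). reach p s (b l) h) \<le> T l"
        using partial_queries_le[OF p, where N=N and i=i and s=s and b="b l"]
        by (simp only: T[OF l] ennreal_le_iff[OF T0])
    qed (use m in auto)
    finally show ?thesis by (simp only: sum_divide_distrib)
  qed
  have "g w \<le> (\<Sum>l\<in>{1..Suc i}. T l) / m + B * (1 - (\<Sum>l\<in>{1..Suc i}. stop_prob p s (b l) i l) / m)"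
  proof (rule LIMSEQ_le_const)
    show "(\<lambda>N. (\<Sum>l\<in>{1..Suc i}. T l) / m + B * (1 - (\<Sum>l\<in>{1..Suc i}. \<Sum>k<N. \<Sum>h\<in>hists i k. reach p s (b l) h * pmf (s h) (Stop l)) / m))
      \<longlonglongrightarrow> (\<Sum>l\<in>{1..Suc i}. T l) / m + B * (1 - (\<Sum>l\<in>{1..Suc i}. stop_prob p s (b l) i l) / m)"
      unfolding stop_prob_def using m
      by (intro tendsto_add tendsto_mult tendsto_diff tendsto_divide tendsto_const tendsto_sum
          summable_LIMSEQ summable_stop_prob[OF p s]) auto
    have "g w \<le> (\<Sum>l\<in>{1..Suc i}. T l) / m + B * (1 - (\<Sum>l\<in>{1..Suc i}. \<Sum>k<N. \<Sum>h\<in>hists i k. reach p s (b l) h * pmf (s h) (Stop l)) / m)" for N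
    proof -
      have "(\<Sum>k<N. \<Sum>h\<in>hists i k. \<Sum>l\<in>{1..Suc i}. ask_weight s h * pmf (s h) (Stop l) * post p b w h l)
          = (\<Sum>k<N. \<Sum>h\<in>hists i k. \<Sum>l\<in>{1..Suc i}. reach p s (b l) h * pmf (s h) (Stop l) / m)"
      proof (intro sum.cong refl)
        fix h l
        have "ask_weight s h * pmf (s h) (Stop l) * post p b w h l = (reach p s (b l) h * w l) * pmf (s h) (Stop l)"
          unfolding reach_eq by simp
        then show "ask_weight s h * pmf (s h) (Stop l) * post p b w h l = reach p s (b l) h * pmf (s h) (Stop l) / m"
          by (simp add: w_def m_def)
      qed
      also have "\<dots> = (\<Sum>k<N. \<Sum>l\<in>{1..Suc i}. \<Sum>h\<in>hists i k. reach p s (b l) h * pmf (s h) (Stop l) / m)"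
        by (intro sum.cong refl sum.swap)
      also have "\<dots> = (\<Sum>l\<in>{1..Suc i}. \<Sum>k<N. \<Sum>h\<in>hists i k. reach p s (b l) h * pmf (s h) (Stop l) / m)"
        by (rule sum.swap)
      also have "\<dots> = (\<Sum>l\<in>{1..Suc i}. \<Sum>k<N. \<Sum>h\<in>hists i k. reach p s (b l) h * pmf (s h) (Stop l)) / m"
        unfolding sum_divide_distrib ..
      finally have K: "(\<Sum>k<N. \<Sum>h\<in>hists i k. \<Sum>l\<in>{1..Suc i}. ask_weight s h * pmf (s h) (Stop l) * post p b w h l)
         = (\<Sum>l\<in>{1..Suc i}. \<Sum>k<N. \<Sum>h\<in>hists i k. reach p s (b l) h * pmf (s h) (Stop l)) / m" .
      have "sum w {1..Suc i} = 1" by (simp add: w_def)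
      from potential_bound[where N=N, OF s step stop nn B this] queries[of N]
      show ?thesis unfolding K by linarith
    qed
    then show "\<exists>N0. \<forall>N\<ge>N0. g w \<le> (\<Sum>l\<in>{1..Suc i}. T l) / m + B * (1 - (\<Sum>l\<in>{1..Suc i}. \<Sum>k<N. \<Sum>h\<in>hists i k. reach p s (b l) h * pmf (s h) (Stop l)) / m)"
      by blast
  qed
  moreover have "(\<Sum>l\<in>{1..Suc i}. T l) / m < g w - B * E"
  proof -
    have "(\<Sum>l\<in>{1..Suc i}. T l) < (\<Sum>l\<in>{1..Suc i}. g w - B * E)"
    proof (rule sum_strict_mono)
      fix l assume l: "l \<in> {1..Suc i}"
      show "T l < g w - B * E" using less[OF l] by (simp only: T[OF l] ennreal_less_iff[OF T0])
    qed auto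
    also have "\<dots> = m * (g w - B * E)" by (simp add: m_def)
    finally show ?thesis using m by (simp add: divide_less_eq mult.commute)
  qed
  moreover have "B * (1 - (\<Sum>l\<in>{1..Suc i}. stop_prob p s (b l) i l) / m) \<le> B * E"
  proof (rule mult_left_mono[OF _ B])
    have "(\<Sum>l\<in>{1..Suc i}. 1 - E) \<le> (\<Sum>l\<in>{1..Suc i}. stop_prob p s (b l) i l)" by (rule sum_mono[OF E])
    then have "m * (1 - E) \<le> (\<Sum>l\<in>{1..Suc i}. stop_prob p s (b l) i l)" by (simp add: m_def del: sum.cl_ivl_Suc)
    then have "1 - E \<le> (\<Sum>l\<in>{1..Suc i}. stop_prob p s (b l) i l) / m"
      using m by (simp add: le_divide_eq mult.commute del: sum.cl_ivl_Suc)
    then show "1 - (\<Sum>l\<in>{1..Suc i}. stop_prob p s (b l) i l) / m \<le> E" by linarith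
  qed
  ultimately show False by linarith
qed

lemma search_converse_noisy:
  assumes p: "0 < p" "p < 1/2" and s: "valid_strat i s" and i: "0 < i" "Suc i \<le> n" and n: "2 < log 2 (real n)"
    and E: "\<And>l. l \<in> {1..Suc i} \<Longrightarrow> 1 - E \<le> stop_prob p s (b l) i l"
  shows "\<exists>l\<in>{1..Suc i}. ennreal (log 2 (Suc i) / (1 - H2 p) + log 2 n / Dpq p - switch p (log 2 n) - 3 / Dpq p
     - (n / Dpq p + (log 2 n)^2 * (1 / (1 - H2 p) + 2 / Dpq p)) * E) \<le> exp_queries p s (b l) i"
proof -
  define I where "I = {1..Suc i}"
  define L where "L = log 2 (real n)"
  define A where "A = switch p L + 3 / Dpq p - L / Dpq p"
  define B where "B = n / Dpq p + L^2 * (1 / (1 - H2 p) + 2 / Dpq p)"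
  define w :: "nat \<Rightarrow> real" where "w = (\<lambda>_. 1 / real (Suc i))"
  \<comment> \<open>\<open>A\<close> is the coefficient of the total mass in
    \<open>pot_terminal\<close>, so only a multiple of the error remains at stopping. Mass is
    additive over the two responses, hence the shift preserves \<open>pot_step\<close>.
    \<open>L\<close> is the logarithm of \<open>n\<close>, not of \<open>Suc i\<close>: all searches
    share the error level 1/n.\<close>
  define g where "g v = pot p L I v - A * sum v I" for v
  have I: "finite I" "card I \<ge> 2" "card I = Suc i" using i by (auto simp: I_def)
  have L: "log 2 (card I) \<le> L" "2 < L" using i n by (auto simp: L_def I)
  have C: "0 < 1 - H2 p" "0 < Dpq p" using H2_less_1[of p] Dpq_pos[of p] p by auto
  have pos: "0 < post p b w h l" for h l
    using p by (induction h) (auto simp: w_def intro!: upd_pos)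
  have "\<exists>l\<in>{1..Suc i}. ennreal (g w - B * E) \<le> exp_queries p s (b l) i"
    unfolding w_def
  proof (rule search_converse[OF _ _ s])
    fix h :: "(nat \<times> bool) list" and j :: nat
    show "g (post p b (\<lambda>_. 1 / real (Suc i)) h) \<le> g (post p b (\<lambda>_. 1 / real (Suc i)) ((j, True) # h))
        + g (post p b (\<lambda>_. 1 / real (Suc i)) ((j, False) # h)) + sum (post p b (\<lambda>_. 1 / real (Suc i)) h) {1..Suc i}"
      using pot_step[OF p I(1,2) _ L, of "post p b w h" "\<lambda>l. b l j"] pos
        arg_cong[OF sum_upd[of p "\<lambda>l. b l j" "post p b w h" I], of "(*) A"]
      unfolding g_def w_def[symmetric] I_def[symmetric] by (simp add: distrib_left)
  next
    fix h :: "(nat \<times> bool) list" and l assume "l \<in> {1..Suc i}"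
    then show "g (post p b (\<lambda>_. 1 / real (Suc i)) h)
        \<le> B * (sum (post p b (\<lambda>_. 1 / real (Suc i)) h) {1..Suc i} - post p b (\<lambda>_. 1 / real (Suc i)) h l)"
      using pot_terminal[OF p I(1,2), of "post p b w h" "real n" l] pos L i
      unfolding g_def w_def[symmetric] I_def[symmetric] B_def A_def L_def by simp
  qed (use p C E in \<open>auto simp: B_def\<close>)
  moreover have "log 2 (Suc i) / (1 - H2 p) - A \<le> g w"
    using pot_uniform[OF I(1,2) L(2), of p] I by (simp add: g_def w_def)
  ultimately obtain l where "l \<in> {1..Suc i}" "ennreal (g w - B * E) \<le> exp_queries p s (b l) i" by blast
  moreover have "ennreal (log 2 (Suc i) / (1 - H2 p) - A - B * E) \<le> ennreal (g w - B * E)"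
    using \<open>_ \<le> g w\<close> by (intro ennreal_leI) simp
  ultimately show ?thesis by (intro bexI[of _ l]) (auto simp: A_def B_def L_def algebra_simps elim: order_trans)
qed

text \<open>Without noise weights may drop to zero, so the log-odds phase is left out. Entropy alone
  serves as potential, with \<open>fano\<close> at stopping; subtracting the mass in
  \<open>g\<close> cancels Fano's one bit.\<close>

lemma search_converse_noiseless:
  assumes s: "valid_strat i s" and i: "0 < i"
    and E: "\<And>l. l \<in> {1..Suc i} \<Longrightarrow> 1 - E \<le> stop_prob 0 s (b l) i l"
  shows "\<exists>l\<in>{1..Suc i}. ennreal (log 2 (Suc i) - 1 - log 2 (Suc i) * E) \<le> exp_queries 0 s (b l) i"
proof -
  define I where "I = {1..Suc i}"
  define w :: "nat \<Rightarrow> real" where "w = (\<lambda>_. 1 / real (Suc i))"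
  define g where "g v = ent I v - sum v I" for v
  have I: "finite I" "card I = Suc i" by (auto simp: I_def)
  have nn: "0 \<le> post 0 b w h l" for h l
    by (induction h) (auto simp: w_def intro!: upd_nonneg)
  have "\<exists>l\<in>{1..Suc i}. ennreal (g w - log 2 (Suc i) * E) \<le> exp_queries 0 s (b l) i"
    unfolding w_def
  proof (rule search_converse[OF _ _ s])
    fix h :: "(nat \<times> bool) list" and j :: nat
    show "g (post 0 b (\<lambda>_. 1 / real (Suc i)) h) \<le> g (post 0 b (\<lambda>_. 1 / real (Suc i)) ((j, True) # h))
        + g (post 0 b (\<lambda>_. 1 / real (Suc i)) ((j, False) # h)) + sum (post 0 b (\<lambda>_. 1 / real (Suc i)) h) {1..Suc i}"
      using ent_step[of 0 I "post 0 b w h" "\<lambda>l. b l j"] nn sum_upd[of 0 "\<lambda>l. b l j" "post 0 b w h" I]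
      unfolding g_def w_def[symmetric] I_def[symmetric] by (simp add: H2_def)
  next
    fix h :: "(nat \<times> bool) list" and l assume "l \<in> {1..Suc i}"
    then show "g (post 0 b (\<lambda>_. 1 / real (Suc i)) h)
        \<le> log 2 (Suc i) * (sum (post 0 b (\<lambda>_. 1 / real (Suc i)) h) {1..Suc i} - post 0 b (\<lambda>_. 1 / real (Suc i)) h l)"
      using fano[OF I(1), of "post 0 b w h" l] nn
      unfolding g_def w_def[symmetric] I_def[symmetric] by (simp add: I mult.commute)
  qed (use E in auto)
  moreover have "g w = log 2 (Suc i) - 1"
    by (simp add: g_def ent_def xlog_def w_def I log_divide)
  ultimately show ?thesis by simp
qed

subsection \<open>From insertion codes to independent searches\<close>

lemma reach_cong:
  assumes "\<And>j. j \<in> {1..i} \<Longrightarrow> b j = b' j" "set h \<subseteq> {1..i} \<times> UNIV"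
  shows "reach p s b h = reach p s b' h"
  using assms(2)
proof (induction h)
  case (Cons a h)
  obtain j y where "a = (j, y)" by (cases a)
  then show ?case using Cons assms(1)[of j] by simp
qed simp

lemma stop_prob_cong:
  assumes "\<And>j. j \<in> {1..i} \<Longrightarrow> b j = b' j"
  shows "stop_prob p s b i = stop_prob p s b' i"
proof
  fix l
  have "reach p s b h = reach p s b' h" if "h \<in> hists i k" for h k
    using that assms by (intro reach_cong[of i]) (auto simp: hists_def)
  then show "stop_prob p s b i l = stop_prob p s b' i l" by (simp add: stop_prob_def cong: sum.cong)
qed

lemma exp_queries_cong:
  assumes "\<And>j. j \<in> {1..i} \<Longrightarrow> b j = b' j"
  shows "exp_queries p s b i = exp_queries p s b' i"
proof -
  have "reach p s b h = reach p s b' h" if "h \<in> hists i k" for h k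
    using that assms by (intro reach_cong[of i]) (auto simp: hists_def)
  then show ?thesis by (simp add: exp_queries_def cong: sum.cong)
qed

section \<open>Orderings prescribed by insertion positions\<close>

lemma set_insert_at [simp]: "set (insert_at L l x) = insert x (set L)"
proof -
  have "set (take (l - 1) L) \<union> set (drop (l - 1) L) = set L" by (metis append_take_drop_id set_append)
  then show ?thesis by (auto simp: insert_at_def)
qed

lemma length_insert_at [simp]: "length (insert_at L l x) = Suc (length L)"
  by (simp add: insert_at_def)

lemma distinct_insert_at: "distinct L \<Longrightarrow> x \<notin> set L \<Longrightarrow> distinct (insert_at L l x)"
  using set_take_disj_set_drop_if_distinct[of L "l - 1" "l - 1"]
  by (auto simp: insert_at_def dest: in_set_takeD in_set_dropD)

lemma insert_at_inject:
  assumes "insert_at L l x = insert_at L' l' x" "x \<notin> set L" "x \<notin> set L'"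
  shows "L = L'" "l \<in> {1..Suc (length L)} \<Longrightarrow> l' \<in> {1..Suc (length L)} \<Longrightarrow> l = l'"
proof -
  have x: "x \<notin> set (take m M)" "x \<notin> set (drop m M)" if "x \<notin> set M" for m M
    using that by (auto dest: in_set_takeD in_set_dropD)
  have *: "take (l - 1) L = take (l' - 1) L' \<and> drop (l - 1) L = drop (l' - 1) L'"
    using assms by (simp add: insert_at_def append_Cons_eq_iff x)
  then show "L = L'" by (metis append_take_drop_id)
  from * have "length (take (l - 1) L) = length (take (l' - 1) L')" by simp
  then show "l \<in> {1..Suc (length L)} \<Longrightarrow> l' \<in> {1..Suc (length L)} \<Longrightarrow> l = l'"
    using \<open>L = L'\<close> by auto
qed

text \<open>A Lehmer-type encoding of orderings: \<open>l i\<close> is the position chosen while the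
  list has \<open>i\<close> elements, so the positions can be picked independently for each
  search.\<close>

fun code_list :: "nat \<Rightarrow> (nat \<Rightarrow> nat) \<Rightarrow> nat \<Rightarrow> nat list" where
  "code_list n l 0 = [n]"
| "code_list n l (Suc k) = insert_at (code_list n l k) (l (Suc k)) (n - Suc k)"

lemma length_code_list [simp]: "length (code_list n l k) = Suc k"
  by (induction k) auto

lemma set_code_list: "k < n \<Longrightarrow> set (code_list n l k) = {n - k..n}"
  by (induction k) (auto simp: le_Suc_eq)

lemma distinct_code_list: "k < n \<Longrightarrow> distinct (code_list n l k)"
  by (induction k) (auto simp: set_code_list intro!: distinct_insert_at)

text \<open>Later insertions only add smaller indices. Hence values that sort the final list also
  sort every intermediate one.\<close>

lemma filter_code_list: "k \<le> K \<Longrightarrow> K < n \<Longrightarrow> filter (\<lambda>y. n - k \<le> y) (code_list n l K) = code_list n l k"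
proof (induction K)
  case (Suc K)
  show ?case
  proof (cases "k = Suc K")
    case True
    then show ?thesis using Suc.prems set_code_list[of "Suc K" n l] by (simp del: code_list.simps)
  next
    case False
    moreover have "filter P (take m M) @ filter P (drop m M) = filter P M" for P m and M :: "nat list"
      by (metis append_take_drop_id filter_append)
    ultimately have "filter (\<lambda>y. n - k \<le> y) (code_list n l (Suc K)) = filter (\<lambda>y. n - k \<le> y) (code_list n l K)"
      using Suc.prems by (simp add: insert_at_def)
    then show ?thesis using False Suc by simp
  qed
qed (auto simp: insert_at_def)

lemma exists_sorting_key:
  assumes "distinct C"
  shows "\<exists>\<theta> :: 'a \<Rightarrow> real. sorted_wrt (\<lambda>a b. \<theta> a < \<theta> b) C"
proof -
  define \<theta> where "\<theta> x = real (SOME i. i < length C \<and> C ! i = x)" for x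
  have "\<theta> (C ! i) = real i" if "i < length C" for i
  proof -
    have "(SOME k. k < length C \<and> C ! k = C ! i) = i"
      using that assms by (intro some_equality) (auto simp: nth_eq_iff_index_eq)
    then show ?thesis by (simp add: \<theta>_def)
  qed
  then have "sorted_wrt (\<lambda>a b. \<theta> a < \<theta> b) C" by (simp add: sorted_wrt_iff_nth_less)
  then show ?thesis by (rule exI[of _ \<theta>])
qed

text \<open>Comparing with elements of a sorted list gives threshold answers. This is where the
  hypothesis family \<open>\<lambda>j. l \<le> j\<close> of the single searches comes from.\<close>

lemma cmp_bits_insert_at:
  assumes "sorted_wrt (\<lambda>a b. \<theta> a < \<theta> b) (insert_at L l x)"
    and "1 \<le> l" "1 \<le> j" "j \<le> length L"
  shows "cmp_bits \<theta> x L j \<longleftrightarrow> l \<le> j"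
proof (cases "l \<le> j")
  case True
  then have "L ! (j - 1) = drop (l - 1) L ! (j - l)" "j - l < length (drop (l - 1) L)"
    using assms(2-) by auto
  then have "L ! (j - 1) \<in> set (drop (l - 1) L)" by (metis nth_mem)
  then show ?thesis using True assms(1) by (auto simp: insert_at_def sorted_wrt_append cmp_bits_def)
next
  case False
  then have "L ! (j - 1) = take (l - 1) L ! (j - 1)" "j - 1 < length (take (l - 1) L)"
    using assms(2-) by auto
  then have "L ! (j - 1) \<in> set (take (l - 1) L)" by (metis nth_mem)
  then have "\<theta> (L ! (j - 1)) < \<theta> x" using assms(1) by (auto simp: insert_at_def sorted_wrt_append)
  then show ?thesis using False by (simp add: cmp_bits_def)
qed

lemma set_spmf_ins_list:
  "k < n \<Longrightarrow> L \<in> set_spmf (ins_list p S n \<theta> k) \<Longrightarrow> set L \<subseteq> {n - k..n}"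
proof (induction k arbitrary: L)
  case (Suc k)
  then obtain L' l where "L' \<in> set_spmf (ins_list p S n \<theta> k)" "L = insert_at L' l (n - Suc k)"
    by (auto simp: set_bind_spmf)
  then show ?case using Suc.IH[of L'] Suc.prems by force
qed simp

definition success :: "real \<Rightarrow> (nat \<Rightarrow> strat) \<Rightarrow> (nat \<Rightarrow> nat) \<Rightarrow> nat \<Rightarrow> real" where
  "success p s l i = stop_prob p (s i) (\<lambda>j. l i \<le> j) i (l i)"

lemma success_bounds:
  assumes p: "0 \<le> p" "p \<le> 1" and s: "valid_strat i (s i)"
  shows "0 \<le> success p s l i" "success p s l i \<le> 1"
proof -
  show "0 \<le> success p s l i" unfolding success_def by (rule stop_prob_nonneg[OF p s])
  show "success p s l i \<le> 1"
    unfolding success_def spmf_search_out[OF p s, symmetric] by (rule pmf_le_1)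
qed

text \<open>Insertion of a new element is injective in the list and in the valid position, so the
  right list can only arise from the right previous list by the right output. Both sums in the bind
  therefore collapse to one term, and there the answers are fixed by \<open>l\<close>.\<close>

lemma spmf_ins_list:
  assumes p: "0 \<le> p" "p \<le> 1" and S: "\<And>i. valid_strat i (S n i)"
    and l: "\<And>i. l i \<in> {1..Suc i}"
    and \<theta>: "sorted_wrt (\<lambda>a b. \<theta> a < \<theta> b) (code_list n l (n - 1))"
  shows "k < n \<Longrightarrow> spmf (ins_list p S n \<theta> k) (code_list n l k) = (\<Prod>i\<in>{1..k}. success p (S n) l i)"
proof (induction k)
  case (Suc k)
  define x where "x = n - Suc k"
  define C where "C = code_list n l k"
  define D where "D = insert_at C (l (Suc k)) x"
  define F where "F L = map_spmf (\<lambda>l. insert_at L l x) (search_out p (S n (Suc k)) (cmp_bits \<theta> x L) (Suc k))" for L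
  have x: "x \<notin> set C" using Suc.prems by (auto simp: C_def x_def set_code_list)
  have D: "D = code_list n l (Suc k)" by (simp add: D_def C_def x_def)
  have "sorted_wrt (\<lambda>a b. \<theta> a < \<theta> b) D"
    unfolding D filter_code_list[of "Suc k" "n - 1" n, symmetric] using Suc.prems \<theta>
    by (subst filter_code_list[symmetric, of "Suc k" "n - 1"]) (auto intro: sorted_wrt_filter)
  then have bits: "cmp_bits \<theta> x C j = (l (Suc k) \<le> j)" if "j \<in> {1..Suc k}" for j
    using that l[of "Suc k"] unfolding D_def by (intro cmp_bits_insert_at) (auto simp: C_def)
  have FC: "spmf (F C) D = success p (S n) l (Suc k)"
  proof -
    let ?s = "search_out p (S n (Suc k)) (cmp_bits \<theta> x C) (Suc k)"
    \<comment> \<open>Out-of-range positions could produce the same list: 0 acts like 1 by truncated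
      subtraction, and every position past the end appends. They must be excluded through their zero
      probability.\<close>
    have supp: "spmf ?s m = 0" if "m \<notin> {1..Suc (Suc k)}" for m
      by (simp only: spmf_search_out[OF p S] stop_prob_outside[OF S that])
    have eq: "insert_at C m x = D \<longleftrightarrow> m = l (Suc k)" if "m \<in> {1..Suc (Suc k)}" for m
      using insert_at_inject(2)[of C m x C "l (Suc k)"] x that l[of "Suc k"] by (auto simp: D_def C_def)
    have "ennreal (spmf (F C) D) = (\<integral>\<^sup>+ m. ennreal (spmf ?s m) * indicator ((\<lambda>m. insert_at C m x) -` {D}) m \<partial>count_space UNIV)"
      unfolding F_def by (simp add: ennreal_spmf_map_conv_nn_integral nn_integral_measure_spmf del: nn_integral_indicator)
    also have "\<dots> = (\<integral>\<^sup>+ m. ennreal (spmf ?s m) * indicator {l (Suc k)} m \<partial>count_space UNIV)"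
    proof (rule nn_integral_cong)
      fix m
      show "ennreal (spmf ?s m) * indicator ((\<lambda>m. insert_at C m x) -` {D}) m = ennreal (spmf ?s m) * indicator {l (Suc k)} m"
        using supp[of m] eq[of m] by (cases "m \<in> {1..Suc (Suc k)}") (auto simp: indicator_def)
    qed
    also have "\<dots> = ennreal (spmf ?s (l (Suc k)))" by simp
    finally have "spmf (F C) D = spmf ?s (l (Suc k))" by simp
    also have "\<dots> = stop_prob p (S n (Suc k)) (\<lambda>j. l (Suc k) \<le> j) (Suc k) (l (Suc k))"
      unfolding spmf_search_out[OF p S] using bits by (subst stop_prob_cong[of "Suc k" _ "\<lambda>j. l (Suc k) \<le> j"]) auto
    finally show ?thesis by (simp add: success_def)
  qed
  have F0: "spmf (F L) D = 0" if "L \<in> set_spmf (ins_list p S n \<theta> k)" "L \<noteq> C" for L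
  proof -
    have "x \<notin> set L" using set_spmf_ins_list[OF _ that(1)] Suc.prems by (fastforce simp: x_def)
    then have "D \<notin> set_spmf (F L)"
      using insert_at_inject(1)[of C "l (Suc k)" x L] x that(2) by (auto simp: F_def D_def)
    then show ?thesis by (simp add: spmf_eq_0_set_spmf)
  qed
  have "ennreal (spmf (ins_list p S n \<theta> (Suc k)) D) = (\<integral>\<^sup>+ L. ennreal (spmf (ins_list p S n \<theta> k) L) * ennreal (spmf (F L) D) \<partial>count_space UNIV)"
    by (simp add: ennreal_spmf_bind nn_integral_measure_spmf F_def x_def)
  also have "\<dots> = (\<integral>\<^sup>+ L. ennreal (spmf (ins_list p S n \<theta> k) C * spmf (F C) D) * indicator {C} L \<partial>count_space UNIV)"
  proof (rule nn_integral_cong)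
    fix L
    show "ennreal (spmf (ins_list p S n \<theta> k) L) * ennreal (spmf (F L) D)
        = ennreal (spmf (ins_list p S n \<theta> k) C * spmf (F C) D) * indicator {C} L"
      using F0[of L] by (cases "L = C"; cases "L \<in> set_spmf (ins_list p S n \<theta> k)")
        (auto simp: ennreal_mult spmf_eq_0_set_spmf)
  qed
  also have "\<dots> = ennreal (spmf (ins_list p S n \<theta> k) C * spmf (F C) D)" by simp
  finally have "spmf (ins_list p S n \<theta> (Suc k)) D = spmf (ins_list p S n \<theta> k) C * spmf (F C) D" by simp
  then show ?case using Suc by (simp add: FC D[symmetric] C_def[symmetric] mult.commute del: code_list.simps ins_list.simps)
qed simp

text \<open>Only the event that all earlier insertions succeeded is counted in the query total. Its
  probability is a prefix of the success product, hence at least the overall success probability,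
  which can be factored out of all searches.\<close>

lemma code_realization:
  assumes p: "0 \<le> p" "p \<le> 1" and S: "\<And>i. valid_strat i (S n i)"
    and l: "\<And>i. l i \<in> {1..Suc i}" and n: "0 < n"
  shows "\<exists>\<theta>. inj_on \<theta> {1..n} \<and> 1 - err_prob p S n \<theta> = (\<Prod>i\<in>{1..n - 1}. success p (S n) l i)
    \<and> ennreal (1 - err_prob p S n \<theta>) * (\<Sum>i\<in>{1..n - 1}. exp_queries p (S n i) (\<lambda>j. l i \<le> j) i) \<le> total_queries p S n \<theta>"
proof -
  let ?C = "code_list n l"
  have set_C: "set (?C (n - 1)) = {1..n}" and dist: "distinct (?C (n - 1))"
    using n set_code_list[of "n - 1" n l] distinct_code_list[of "n - 1" n l] by auto
  obtain \<theta> :: "nat \<Rightarrow> real" where \<theta>: "sorted_wrt (\<lambda>a b. \<theta> a < \<theta> b) (?C (n - 1))"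
    using exists_sorting_key[OF dist] by blast
  have inj: "inj_on \<theta> {1..n}"
  proof (rule inj_onI, rule ccontr)
    fix a b assume ab: "a \<in> {1..n}" "b \<in> {1..n}" "\<theta> a = \<theta> b" "a \<noteq> b"
    then obtain u v where uv: "u < length (?C (n - 1))" "v < length (?C (n - 1))" "a = ?C (n - 1) ! u" "b = ?C (n - 1) ! v"
      unfolding set_C[symmetric] by (auto simp: in_set_conv_nth)
    then have "u \<noteq> v" using ab by auto
    then have "u < v \<or> v < u" by auto
    then show False
      using sorted_wrt_nth_less[OF \<theta>, of u v] sorted_wrt_nth_less[OF \<theta>, of v u] uv ab(3) by auto
  qed
  have sort: "sort_key \<theta> [1..<n+1] = ?C (n - 1)"
  proof (rule sort_key_inj_key_eq)
    show "mset [1..<n+1] = mset (?C (n - 1))"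
      using mset_set_set[OF dist] unfolding set_C by (simp add: atLeastLessThanSuc_atLeastAtMost del: upt_Suc)
    show "inj_on \<theta> (set [1..<n+1])" using inj by (simp add: atLeastLessThanSuc_atLeastAtMost del: upt_Suc)
    show "sorted (map \<theta> (?C (n - 1)))"
      using \<theta> by (auto simp: sorted_wrt_map intro: sorted_wrt_mono_rel[rotated] less_imp_le)
  qed
  note spmf = spmf_ins_list[where p=p and S=S and n=n and l=l and \<theta>=\<theta>, OF p S l \<theta>]
  have err: "1 - err_prob p S n \<theta> = (\<Prod>i\<in>{1..n - 1}. success p (S n) l i)"
    unfolding err_prob_def sort using n by (subst spmf) auto
  have "ennreal (1 - err_prob p S n \<theta>) * (\<Sum>i\<in>{1..n - 1}. exp_queries p (S n i) (\<lambda>j. l i \<le> j) i)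
      = (\<Sum>k<n - 1. ennreal (1 - err_prob p S n \<theta>) * exp_queries p (S n (Suc k)) (\<lambda>j. l (Suc k) \<le> j) (Suc k))"
    unfolding sum_distrib_left by (rule sum.reindex_bij_witness[of _ Suc "\<lambda>i. i - 1"]) auto
  also have "\<dots> \<le> total_queries p S n \<theta>"
    unfolding total_queries_def
  proof (rule sum_mono)
    fix k assume k: "k \<in> {..<n - 1}"
    let ?T = "\<lambda>L. exp_queries p (S n (Suc k)) (cmp_bits \<theta> (n - Suc k) L) (Suc k)"
    have "sorted_wrt (\<lambda>a b. \<theta> a < \<theta> b) (?C (Suc k))"
      using k \<theta> by (subst filter_code_list[symmetric, of "Suc k" "n - 1"]) (auto intro: sorted_wrt_filter)
    then have bits: "cmp_bits \<theta> (n - Suc k) (?C k) j = (l (Suc k) \<le> j)" if "j \<in> {1..Suc k}" for j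
      using that l[of "Suc k"] by (intro cmp_bits_insert_at) auto
    have T: "?T (?C k) = exp_queries p (S n (Suc k)) (\<lambda>j. l (Suc k) \<le> j) (Suc k)"
      by (rule exp_queries_cong) (rule bits)
    have "(\<Prod>i\<in>{1..n - 1}. success p (S n) l i) \<le> (\<Prod>i\<in>{1..k}. success p (S n) l i)"
    proof -
      have "(\<Prod>i\<in>{1..n - 1} - {1..k}. success p (S n) l i) * (\<Prod>i\<in>{1..k}. success p (S n) l i)
          \<le> 1 * (\<Prod>i\<in>{1..k}. success p (S n) l i)"
        using success_bounds[OF p, of _ "S n" l] S by (intro mult_right_mono prod_le_1 prod_nonneg) auto
      moreover have "{1..k} \<subseteq> {1..n - 1}" using k by auto
      ultimately show ?thesis by (subst prod.subset_diff[of "{1..k}" "{1..n - 1}"]) auto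
    qed
    then have "1 - err_prob p S n \<theta> \<le> spmf (ins_list p S n \<theta> k) (?C k)"
      using k by (subst spmf) (auto simp: err)
    then have "ennreal (1 - err_prob p S n \<theta>) * exp_queries p (S n (Suc k)) (\<lambda>j. l (Suc k) \<le> j) (Suc k)
      \<le> ennreal (spmf (ins_list p S n \<theta> k) (?C k)) * ?T (?C k)"
      by (intro mult_mono ennreal_leI) (simp_all add: T)
    also have "\<dots> \<le> (\<integral>\<^sup>+ L. ennreal (spmf (ins_list p S n \<theta> k) L) * ?T L \<partial>count_space UNIV)"
      by (rule nn_integral_ge_point) simp
    also have "\<dots> = (\<integral>\<^sup>+ L. ?T L \<partial>measure_spmf (ins_list p S n \<theta> k))"
      by (simp add: nn_integral_measure_spmf)
    finally show "ennreal (1 - err_prob p S n \<theta>) * exp_queries p (S n (Suc k)) (\<lambda>j. l (Suc k) \<le> j) (Suc k)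
      \<le> (\<integral>\<^sup>+ L. ?T L \<partial>measure_spmf (ins_list p S n \<theta> k))" .
  qed
  finally show ?thesis using inj err by blast
qed

subsection \<open>The rate bound\<close>

definition inv_D :: "real \<Rightarrow> real" where
  "inv_D p = (if p = 0 then 0 else 1 / Dpq p)"

text \<open>Merges the noisy and noiseless cases under one constant that depends on \<open>p\<close>
  alone. Since L = log n, \<open>switch\<close> is of order log log n and disappears into the
  correction term.\<close>

lemma search_converse_uniform:
  assumes p: "0 \<le> p" "p < 1/2"
  shows "\<exists>K\<ge>0. \<forall>(n::nat) i s b E. valid_strat i s \<longrightarrow> 0 < i \<longrightarrow> i < n \<longrightarrow> 2 < log 2 n \<longrightarrow> 0 \<le> E \<longrightarrow>
    (\<forall>l\<in>{1..Suc i}. 1 - E \<le> stop_prob p s (b l) i l) \<longrightarrow>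
    (\<exists>l\<in>{1..Suc i}. ennreal (log 2 (Suc i) / (1 - H2 p) + inv_D p * log 2 n
       - K * (1 + log 2 (log 2 n)) - K * (n + (log 2 n)^2) * E) \<le> exp_queries p s (b l) i)"
proof (cases "p = 0")
  case True
  show ?thesis
  proof (rule exI[of _ 1], safe)
    fix n i :: nat and s b and E :: real
    assume A: "valid_strat i s" "0 < i" "i < n" "2 < log 2 n" "0 \<le> E" "\<forall>l\<in>{1..Suc i}. 1 - E \<le> stop_prob p s (b l) i l"
    obtain l where l: "l \<in> {1..Suc i}" "ennreal (log 2 (Suc i) - 1 - log 2 (Suc i) * E) \<le> exp_queries 0 s (b l) i"
      using search_converse_noiseless[OF A(1,2), of E b] A(6) True by blast
    have "log 2 (Suc i) \<le> log 2 n" using A(3) by simp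
    also have "\<dots> \<le> (log 2 n)^2" using A(4) by (simp add: power2_eq_square)
    also have "\<dots> \<le> n + (log 2 n)^2" by simp
    finally have "log 2 (Suc i) * E \<le> (n + (log 2 n)^2) * E" using A(5) by (intro mult_right_mono)
    moreover have "0 \<le> log 2 (log 2 n)" using A(4) by simp
    ultimately have "ennreal (log 2 (Suc i) / (1 - H2 p) + inv_D p * log 2 n
       - 1 * (1 + log 2 (log 2 n)) - 1 * (n + (log 2 n)^2) * E) \<le> ennreal (log 2 (Suc i) - 1 - log 2 (Suc i) * E)"
      using True by (intro ennreal_leI) (simp add: inv_D_def H2_def)
    then show "\<exists>l\<in>{1..Suc i}. ennreal (log 2 (Suc i) / (1 - H2 p) + inv_D p * log 2 n
       - 1 * (1 + log 2 (log 2 n)) - 1 * (n + (log 2 n)^2) * E) \<le> exp_queries p s (b l) i"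
      using l True by (intro bexI[of _ l]) (auto elim: order_trans)
  qed simp
next
  case False
  then have p: "0 < p" "p < 1/2" using p by auto
  have C: "0 < 1 - H2 p" "0 < Dpq p" using H2_less_1[of p] Dpq_pos[of p] p by auto
  define c where "c = 1 / (1 - H2 p)"
  define d where "d = 1 / Dpq p"
  define a where "a = log 2 (1 / p)"
  \<comment> \<open>Large enough to dominate each coefficient met below: the constant
    \<open>2 * c + (a + 3) * d\<close>, \<open>d\<close> for log log n and for n, and
    \<open>c + 2 * d\<close> for L^2.\<close>
  define K where "K = 2 * c + (a + 4) * d"
  have pos: "0 < c" "0 < d" "0 < a" using C p by (auto simp: c_def d_def a_def)
  have K0: "0 \<le> K" using pos by (simp add: K_def)
  show ?thesis
  proof (rule exI[of _ K], safe)
    fix n i :: nat and s b and E :: real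
    assume A: "valid_strat i s" "0 < i" "i < n" "2 < log 2 n" "0 \<le> E" "\<forall>l\<in>{1..Suc i}. 1 - E \<le> stop_prob p s (b l) i l"
    define L where "L = log 2 n"
    obtain l where l: "l \<in> {1..Suc i}" "ennreal (log 2 (Suc i) / (1 - H2 p) + log 2 n / Dpq p - switch p (log 2 n) - 3 / Dpq p
     - (n / Dpq p + (log 2 n)^2 * (1 / (1 - H2 p) + 2 / Dpq p)) * E) \<le> exp_queries p s (b l) i"
      using search_converse_noisy[OF p A(1,2) _ A(4), of E b] A(3,6) by auto
    have LL: "0 \<le> log 2 L" using A(4) by (simp add: L_def)
    have "switch p L + 3 * d = 2 * c + (a + 3) * d + d * log 2 L"
      by (simp add: switch_def c_def d_def a_def add_divide_distrib algebra_simps)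
    also have "\<dots> \<le> K + K * log 2 L"
      using pos LL by (intro add_mono mult_right_mono) (auto simp: K_def algebra_simps)
    finally have 1: "switch p L + 3 * d \<le> K * (1 + log 2 L)" by (simp add: algebra_simps)
    have "n * d + L^2 * (c + 2 * d) \<le> n * K + L^2 * K"
      using pos by (intro add_mono mult_left_mono) (auto simp: K_def algebra_simps)
    then have 2: "(n * d + L^2 * (c + 2 * d)) * E \<le> K * (n + L^2) * E"
      using A(5) by (intro mult_right_mono) (auto simp: algebra_simps)
    have "ennreal (log 2 (Suc i) / (1 - H2 p) + inv_D p * log 2 n
       - K * (1 + log 2 (log 2 n)) - K * (n + (log 2 n)^2) * E) \<le> ennreal (log 2 (Suc i) / (1 - H2 p) + log 2 n / Dpq p - switch p (log 2 n) - 3 / Dpq p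
     - (n / Dpq p + (log 2 n)^2 * (1 / (1 - H2 p) + 2 / Dpq p)) * E)"
      using 1 2 p unfolding L_def[symmetric]
      by (intro ennreal_leI) (simp add: inv_D_def c_def d_def)
    then show "\<exists>l\<in>{1..Suc i}. ennreal (log 2 (Suc i) / (1 - H2 p) + inv_D p * log 2 n
       - K * (1 + log 2 (log 2 n)) - K * (n + (log 2 n)^2) * E) \<le> exp_queries p s (b l) i"
      using l by (intro bexI[of _ l]) (auto elim: order_trans)
  qed (use K0 in simp)
qed

text \<open>From 1 - q \<le> -ln q, the defects add up to at most -ln of the product, and ln 2 \<le>
  1. Thus a code that succeeds with probability 1/2 has a total error budget of 1 over all its
  searches.\<close>

lemma sum_defect_le_1:
  fixes q :: "'a \<Rightarrow> real"
  assumes A: "finite A" and q: "\<And>i. i \<in> A \<Longrightarrow> 0 \<le> q i" and P: "1/2 \<le> (\<Prod>i\<in>A. q i)"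
  shows "(\<Sum>i\<in>A. 1 - q i) \<le> 1"
proof -
  have pos: "0 < q i" if "i \<in> A" for i
    using q[OF that] P A that by (cases "q i = 0") (auto simp: prod_zero_iff less_le dest!: prod_zero)
  have "(\<Sum>i\<in>A. 1 - q i) \<le> (\<Sum>i\<in>A. - ln (q i))"
    using ln_le_minus_one[OF pos] by (intro sum_mono) fastforce
  also have "\<dots> = - ln (\<Prod>i\<in>A. q i)" by (subst ln_prod) (use pos A in \<open>fastforce simp: sum_negf\<close>)+
  also have "\<dots> \<le> - ln (1/2)" using P by simp
  also have "\<dots> \<le> 1" using ln_le_minus_one[of 2] by (simp add: ln_div)
  finally show ?thesis .
qed

text \<open>The summands may be negative; \<open>ennreal\<close> clips them to 0 and so can only
  enlarge the right side.\<close>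

lemma sum_ennreal_ge: "ennreal (\<Sum>i\<in>A. f i) \<le> (\<Sum>i\<in>A. ennreal (f i))"
proof (induction A rule: infinite_finite_induct)
  case (insert x F)
  have "ennreal (f x + sum f F) \<le> ennreal (f x) + ennreal (sum f F)"
    by (cases "0 \<le> f x"; cases "0 \<le> sum f F")
      (auto simp: ennreal_plus ennreal_neg intro!: order_trans[OF ennreal_leI[of _ "f x"]] order_trans[OF ennreal_leI[of _ "sum f F"]])
  also have "\<dots> \<le> ennreal (f x) + (\<Sum>i\<in>F. ennreal (f i))" using insert by (intro add_left_mono)
  finally show ?case using insert by simp
qed auto

section \<open>Stirling-type bound and passage to the limit\<close>

lemma ln_fact_ge: "real n * ln (real n) - real n \<le> ln (fact n)"
proof (induction n)
  case (Suc n)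
  have "real n * ln (1 + real n) \<le> real n * ln (real n) + 1"
  proof (cases "n = 0")
    case False
    have "ln (1 + 1 / real n) \<le> 1 / real n" using False ln_le_minus_one[of "1 + 1 / real n"] by (simp add: add_pos_pos)
    moreover have "1 + 1 / real n = (1 + real n) / real n" using False by (simp add: field_simps)
    ultimately have "ln (1 + real n) - ln (real n) \<le> 1 / real n" using False by (simp add: ln_div)
    then show ?thesis using False by (simp add: field_simps)
  qed simp
  moreover have "ln (fact (Suc n)) = ln (1 + real n) + ln (fact n)" by (simp add: ln_mult)
  ultimately show ?case using Suc by (simp add: distrib_right del: fact_Suc)
qed simp

lemma sum_log_ge:
  assumes "0 < n"
  shows "real n * log 2 (real n) - 2 * real n \<le> (\<Sum>i\<in>{1..n - 1}. log 2 (real (Suc i)))"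
proof -
  have "(\<Sum>i\<in>{1..m}. ln (real (Suc i))) = ln (fact (Suc m))" for m
    by (induction m) (simp_all add: ln_mult)
  from this[of "n - 1"] have "(\<Sum>i\<in>{1..n - 1}. log 2 (real (Suc i))) = ln (fact n) / ln 2"
    using assms by (simp add: log_def sum_divide_distrib[symmetric])
  also have "\<dots> \<ge> (real n * ln (real n) - real n) / ln 2"
    using ln_fact_ge by (intro divide_right_mono) auto
  also have "(real n * ln (real n) - real n) / ln 2 = real n * log 2 (real n) - real n / ln 2"
    by (simp add: log_def diff_divide_distrib)
  moreover have "real n / ln 2 \<le> 2 * real n"
    using ln2_ge_two_thirds mult_right_mono[of "1" "2 * ln 2" "real n"] by (simp add: divide_le_eq mult_ac)
  ultimately show ?thesis by linarith
qed

text \<open>Two adversarial orderings are used. Positions \<open>lE\<close>, the least reliable for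
  each search, bound the sum of the worst-case errors; positions \<open>lT\<close>, the slow ones
  from the single-search converse, then force many queries.\<close>

lemma total_queries_lower_bound:
  assumes p: "0 \<le> p" "p < 1/2"
  shows "\<exists>K::real. \<forall>S (n::nat) e. (\<forall>i. valid_strat i (S n i)) \<longrightarrow> 2 < log 2 n \<longrightarrow> e \<le> 1/2 \<longrightarrow>
    (\<forall>\<theta>. inj_on \<theta> {1..n} \<longrightarrow> err_prob p S n \<theta> \<le> e) \<longrightarrow>
    (\<exists>\<theta>. inj_on \<theta> {1..n} \<and> ennreal ((1 - e) * ((n * log 2 n - 2 * n) / (1 - H2 p) + inv_D p * (n - 1) * log 2 n
       - K * n * (1 + log 2 (log 2 n)) - K * (n + (log 2 n)^2))) \<le> total_queries p S n \<theta>)"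
proof -
  obtain K where K: "K \<ge> 0" "\<And>n i s b E. valid_strat i s \<Longrightarrow> 0 < i \<Longrightarrow> i < n \<Longrightarrow> 2 < log 2 (real n) \<Longrightarrow> 0 \<le> E \<Longrightarrow>
    (\<forall>l\<in>{1..Suc i}. 1 - E \<le> stop_prob p s (b l) i l) \<Longrightarrow>
    (\<exists>l\<in>{1..Suc i}. ennreal (log 2 (Suc i) / (1 - H2 p) + inv_D p * log 2 n
       - K * (1 + log 2 (log 2 n)) - K * (n + (log 2 n)^2) * E) \<le> exp_queries p s (b l) i)"
    using search_converse_uniform[OF p] by metis
  have p1: "p \<le> 1" using p by simp
  show ?thesis
  proof (rule exI[of _ K], safe)
    fix S :: "nat \<Rightarrow> nat \<Rightarrow> strat" and n :: nat and e :: real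
    assume S: "\<forall>i. valid_strat i (S n i)" and n: "2 < log 2 n" and e: "e \<le> 1/2"
      and err: "\<forall>\<theta>. inj_on \<theta> {1..n} \<longrightarrow> err_prob p S n \<theta> \<le> e"
    have S': "valid_strat i (S n i)" for i using S by blast
    have n0: "0 < n" using n by (cases n) (auto simp: log_def)
    define L where "L = log 2 (real n)"
    define q where "q i l = stop_prob p (S n i) (\<lambda>j. l \<le> j) i l" for i l
    have q: "success p (S n) l i = q i (l i)" for l i by (simp add: success_def q_def)
    have "\<exists>l\<in>{1..Suc i}. \<forall>l'\<in>{1..Suc i}. q i l \<le> q i l'" for i
    proof -
      have "Min (q i ` {1..Suc i}) \<in> q i ` {1..Suc i}" by (rule Min_in) auto
      then obtain l where l: "l \<in> {1..Suc i}" "q i l = Min (q i ` {1..Suc i})" by force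
      have "q i l \<le> q i l'" if "l' \<in> {1..Suc i}" for l'
        unfolding l(2) by (rule Min_le) (use that in blast)+
      then show ?thesis using l(1) by blast
    qed
    then obtain lE where lE: "\<And>i. lE i \<in> {1..Suc i}" "\<And>i l'. l' \<in> {1..Suc i} \<Longrightarrow> q i (lE i) \<le> q i l'"
      by metis
    define E where "E i = 1 - q i (lE i)" for i
    have E0: "0 \<le> E i" for i
      using success_bounds[OF p(1) p1, of i "S n" lE] S' by (simp add: E_def q)
    define X where "X i = log 2 (Suc i) / (1 - H2 p) + inv_D p * L - K * (1 + log 2 L) - K * (n + L^2) * E i" for i
    have "\<exists>l\<in>{1..Suc i}. i \<in> {1..n - 1} \<longrightarrow> ennreal (X i) \<le> exp_queries p (S n i) (\<lambda>j. l \<le> j) i" for i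
    proof (cases "i \<in> {1..n - 1}")
      case True
      have "\<exists>l\<in>{1..Suc i}. ennreal (log 2 (Suc i) / (1 - H2 p) + inv_D p * log 2 n
       - K * (1 + log 2 (log 2 n)) - K * (n + (log 2 n)^2) * E i) \<le> exp_queries p (S n i) (\<lambda>j. l \<le> j) i"
        using True lE(2) by (intro K(2)[OF S' _ _ n E0]) (auto simp: E_def q_def[symmetric])
      then show ?thesis unfolding X_def L_def by blast
    qed (auto intro: bexI[of _ 1])
    then obtain lT where lT: "\<And>i. lT i \<in> {1..Suc i}"
      "\<And>i. i \<in> {1..n - 1} \<Longrightarrow> ennreal (X i) \<le> exp_queries p (S n i) (\<lambda>j. lT i \<le> j) i"
      by metis
    obtain \<theta>E where \<theta>E: "inj_on \<theta>E {1..n}" "1 - err_prob p S n \<theta>E = (\<Prod>i\<in>{1..n - 1}. q i (lE i))"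
      using code_realization[where S=S and n=n and l=lE, OF p(1) p1 S' lE(1) n0] unfolding q by blast
    have sumE: "(\<Sum>i\<in>{1..n - 1}. E i) \<le> 1"
      unfolding E_def
    proof (rule sum_defect_le_1)
      show "1/2 \<le> (\<Prod>i\<in>{1..n - 1}. q i (lE i))" using err \<theta>E e by fastforce
      show "0 \<le> q i (lE i)" for i using success_bounds[OF p(1) p1, of i "S n" lE] S' by (simp add: q)
    qed simp
    \<comment> \<open>\<open>lT\<close> need not agree with \<open>lE\<close>: each
      \<open>E i\<close> bounds the error at every position, and \<open>e\<close> bounds the error
      of every ordering, so both estimates hold here too.\<close>
    obtain \<theta> where \<theta>: "inj_on \<theta> {1..n}"
      "ennreal (1 - err_prob p S n \<theta>) * (\<Sum>i\<in>{1..n - 1}. exp_queries p (S n i) (\<lambda>j. lT i \<le> j) i) \<le> total_queries p S n \<theta>"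
      using code_realization[where S=S and n=n and l=lT, OF p(1) p1 S' lT(1) n0] by blast
    have C: "0 < 1 - H2 p" using H2_less_1[OF p] by simp
    have LL: "0 \<le> log 2 L" using n by (simp add: L_def)
    have "(n * L - 2 * n) / (1 - H2 p) + inv_D p * (n - 1) * L - K * n * (1 + log 2 L) - K * (n + L^2) \<le> (\<Sum>i\<in>{1..n - 1}. X i)"
    proof -
      have "(n * L - 2 * n) / (1 - H2 p) \<le> (\<Sum>i\<in>{1..n - 1}. log 2 (Suc i)) / (1 - H2 p)"
        unfolding L_def using C sum_log_ge[OF n0] by (intro divide_right_mono) simp_all
      moreover have "K * (1 + log 2 L) * (n - 1) \<le> K * (1 + log 2 L) * n"
        using K(1) LL by (intro mult_left_mono) auto
      moreover have "K * (n + L^2) * (\<Sum>i\<in>{1..n - 1}. E i) \<le> K * (n + L^2) * 1"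
        using K(1) sumE by (intro mult_left_mono) auto
      moreover have "(\<Sum>i\<in>{1..n - 1}. X i) = (\<Sum>i\<in>{1..n - 1}. log 2 (Suc i)) / (1 - H2 p)
          + (n - 1) * (inv_D p * L) - (n - 1) * (K * (1 + log 2 L)) - K * (n + L^2) * (\<Sum>i\<in>{1..n - 1}. E i)"
        unfolding X_def by (simp add: sum.distrib sum_subtractf sum_divide_distrib sum_distrib_left)
      ultimately show ?thesis by (simp add: mult_ac)
    qed
    then have "(1 - e) * ((n * L - 2 * n) / (1 - H2 p) + inv_D p * (n - 1) * L - K * n * (1 + log 2 L) - K * (n + L^2))
        \<le> (1 - e) * (\<Sum>i\<in>{1..n - 1}. X i)"
      using e by (intro mult_left_mono) auto
    then have "ennreal ((1 - e) * ((n * L - 2 * n) / (1 - H2 p) + inv_D p * (n - 1) * L - K * n * (1 + log 2 L) - K * (n + L^2)))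
        \<le> ennreal ((1 - e) * (\<Sum>i\<in>{1..n - 1}. X i))"
      by (rule ennreal_leI)
    also have "\<dots> = ennreal (1 - e) * ennreal (\<Sum>i\<in>{1..n - 1}. X i)"
      using e by (intro ennreal_mult') simp
    also have "\<dots> \<le> ennreal (1 - err_prob p S n \<theta>) * (\<Sum>i\<in>{1..n - 1}. exp_queries p (S n i) (\<lambda>j. lT i \<le> j) i)"
    proof (intro mult_mono ennreal_leI)
      show "1 - e \<le> 1 - err_prob p S n \<theta>" using err \<theta>(1) by simp
      have "ennreal (\<Sum>i\<in>{1..n - 1}. X i) \<le> (\<Sum>i\<in>{1..n - 1}. ennreal (X i))" by (rule sum_ennreal_ge)
      also have "\<dots> \<le> (\<Sum>i\<in>{1..n - 1}. exp_queries p (S n i) (\<lambda>j. lT i \<le> j) i)" by (intro sum_mono lT(2))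
      finally show "ennreal (\<Sum>i\<in>{1..n - 1}. X i) \<le> (\<Sum>i\<in>{1..n - 1}. exp_queries p (S n i) (\<lambda>j. lT i \<le> j) i)" .
    qed auto
    also note \<theta>(2)
    finally show "\<exists>\<theta>. inj_on \<theta> {1..n} \<and> ennreal ((1 - e) * ((n * log 2 n - 2 * n) / (1 - H2 p) + inv_D p * (n - 1) * log 2 n
       - K * n * (1 + log 2 (log 2 n)) - K * (n + (log 2 n)^2))) \<le> total_queries p S n \<theta>"
      using \<theta>(1) unfolding L_def by blast
  qed
qed

lemma achievable_le:
  assumes p: "0 \<le> p" "p < 1/2" and R: "ins_achievable p R" "0 < R"
  shows "R * (1 / (1 - H2 p) + inv_D p) \<le> 1"
proof -
  obtain S where S: "\<And>n i. valid_strat i (S n i)"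
    and rate: "\<forall>\<^sub>F n in sequentially. ennreal R * (SUP \<theta>\<in>{\<theta>. inj_on \<theta> {1..n}}. total_queries p S n \<theta>)
      \<le> ennreal (real n * log 2 (real n))"
    and err: "(\<lambda>n. SUP \<theta>\<in>{\<theta>. inj_on \<theta> {1..n}}. err_prob p S n \<theta>) \<longlonglongrightarrow> 0"
    using R(1) unfolding ins_achievable_def by blast
  obtain K :: real where K: "\<And>S (n::nat) e. (\<And>i. valid_strat i (S n i)) \<Longrightarrow> 2 < log 2 n \<Longrightarrow> e \<le> 1/2 \<Longrightarrow>
    (\<And>\<theta>. inj_on \<theta> {1..n} \<Longrightarrow> err_prob p S n \<theta> \<le> e) \<Longrightarrow>
    (\<exists>\<theta>. inj_on \<theta> {1..n} \<and> ennreal ((1 - e) * ((n * log 2 n - 2 * n) / (1 - H2 p) + inv_D p * (n - 1) * log 2 n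
       - K * n * (1 + log 2 (log 2 n)) - K * (n + (log 2 n)^2))) \<le> total_queries p S n \<theta>)"
    using total_queries_lower_bound[OF p] by metis
  define e where "e n = (SUP \<theta>\<in>{\<theta>. inj_on \<theta> {1..n}}. err_prob p S n \<theta>)" for n
  define B where "B n = (real n * log 2 n - 2 * n) / (1 - H2 p) + inv_D p * (n - 1) * log 2 n
       - K * n * (1 + log 2 (log 2 n)) - K * (n + (log 2 n)^2)" for n :: nat
  have e: "err_prob p S n \<theta> \<le> e n" if "inj_on \<theta> {1..n}" for \<theta> n
    unfolding e_def using that
    by (intro cSUP_upper bdd_aboveI[of _ 1]) (auto simp: err_prob_def)
  have err_half: "\<forall>\<^sub>F n in sequentially. e n < 1/2"
    using order_tendstoD(2)[OF err[folded e_def], of "1/2"] by simp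
  have bound: "\<forall>\<^sub>F n in sequentially. R * ((1 - e n) * (B n / (real n * log 2 n))) \<le> 1"
    using rate err_half eventually_gt_at_top[of 4]
  proof eventually_elim
    case (elim n)
    have n: "2 < log 2 (real n)"
    proof -
      have "log 2 4 < log 2 (real n)" using elim(3) by simp
      moreover have "log 2 4 = (2::real)" using log_pow_cancel[of 2 2] by simp
      ultimately show ?thesis by simp
    qed
    then obtain \<theta> where \<theta>: "inj_on \<theta> {1..n}" "ennreal ((1 - e n) * B n) \<le> total_queries p S n \<theta>"
      using K[of S n "e n", OF S n _ e] elim(2) unfolding B_def by fastforce
    have "ennreal (R * ((1 - e n) * B n)) = ennreal R * ennreal ((1 - e n) * B n)"
      using R(2) by (intro ennreal_mult') simp
    also have "\<dots> \<le> ennreal R * (SUP \<theta>\<in>{\<theta>. inj_on \<theta> {1..n}}. total_queries p S n \<theta>)"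
      using \<theta> by (intro mult_left_mono) (auto intro: SUP_upper2)
    also note elim(1)
    finally have "ennreal (R * ((1 - e n) * B n)) \<le> ennreal (real n * log 2 (real n))" .
    moreover have nL: "0 < real n * log 2 (real n)" using n elim(3) by (intro mult_pos_pos) auto
    ultimately have "R * ((1 - e n) * B n) \<le> real n * log 2 (real n)" by (simp add: ennreal_le_iff)
    then show ?case using nL by (simp add: divide_le_eq)
  qed
  have lim: "(\<lambda>n. R * ((1 - e n) * (B n / (real n * log 2 n)))) \<longlonglongrightarrow> R * ((1 - 0) * (1 * (1 / (1 - H2 p)) + inv_D p * 1 - K * 0 - K * 0))"
  proof (intro tendsto_mult tendsto_diff tendsto_const err[folded e_def])
    \<comment> \<open>\<open>B n / (n log n)\<close> split into quotients free of \<open>p\<close>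
      and \<open>K\<close>, so that each limit is a purely asymptotic question. The corrections of
      order n log log n and n + (log n)^2 vanish.\<close>
    define Q where "Q n = (real n * log 2 n - 2 * n) / (real n * log 2 n) * (1 / (1 - H2 p))
       + inv_D p * (((real n - 1) * log 2 n) / (real n * log 2 n))
       - K * ((n * (1 + log 2 (log 2 n))) / (real n * log 2 n)) - K * ((n + (log 2 n)^2) / (real n * log 2 n))" for n :: nat
    have lim_Q: "Q \<longlonglongrightarrow> (1 * (1 / (1 - H2 p)) + inv_D p * 1 - K * 0 - K * 0)"
      unfolding Q_def by (intro tendsto_add tendsto_mult tendsto_diff tendsto_const; real_asymp)
    have "Q n = B n / (real n * log 2 n)" if "0 < n" for n
    proof -
      define X where "X = real n * log 2 n"
      show ?thesis
        using that unfolding B_def Q_def X_def[symmetric] by (simp add: divide_inverse of_nat_diff algebra_simps)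
    qed
    then show "(\<lambda>n. B n / (real n * log 2 n)) \<longlonglongrightarrow> (1 * (1 / (1 - H2 p)) + inv_D p * 1 - K * 0 - K * 0)"
      by (intro Lim_transform_eventually[OF lim_Q] eventually_mono[OF eventually_gt_at_top[of 0]])
  qed
  show ?thesis using tendsto_upperbound[OF lim bound] by simp
qed

theorem theorem4:
  fixes p :: real
  assumes "0 \<le> p" and "p < 1/2"
  shows "C_ins p \<le> ereal (ins_bound p)"
proof -
  have C: "0 < 1 / (1 - H2 p)" using H2_less_1[OF assms] by simp
  have D: "0 \<le> inv_D p" using Dpq_pos[of p] assms by (cases "p = 0") (auto simp: inv_D_def)
  have eq: "ins_bound p = 1 / (1 / (1 - H2 p) + inv_D p)" by (simp add: ins_bound_def inv_D_def)
  have "R \<le> ins_bound p" if "ins_achievable p R" for R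
  proof (cases "0 < R")
    case True
    then show ?thesis using achievable_le[OF assms that] C D unfolding eq by (subst pos_le_divide_eq) (auto intro: add_pos_nonneg)
  next
    \<comment> \<open>\<open>ennreal R\<close> is 0 here, so the rate condition says nothing about
      \<open>R\<close>; positivity of the bound is enough.\<close>
    case False
    then show ?thesis using C D by (simp add: eq order_trans[of R 0])
  qed
  then show ?thesis unfolding C_ins_def by (auto intro!: Sup_least)
qed

end
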